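(* Let $k$ be a field, let $D$ be a division $k$-algebra, let $\sigma\colon D\to D$ be a $k$-automorphism and let $\delta\colon D\to D$ be a $\sigma$-derivation. Let $a_0,a_1,b_0,b_1\in k$ with $a_1\neq 0$, let $f=a_0+a_1X$ and $g=b_0+b_1X$ in $k[X]\subseteq D[X;\sigma,\delta]$, and assume that $\Xi=gf^{-1}\in D(X;\sigma,\delta)\setminus k$. Let $\psi\colon D\to D$ be the map $\psi=a_1\delta+a_0(\mathrm{Id}-\sigma)$, where $\mathrm{Id}$ is the identity map of $D$, and let $E=\ker\psi$. Let $n$ be an integer with $n\geq 2$, and let $\alpha_1,\dots,\alpha_n\in D$ be such that \begin{itemize} \item $\{\alpha_1,\dots,\alpha_n\}$ is left linearly independent over $\sigma(E)$, and \item $\psi(D)\cap\bigl(\sigma(E)\alpha_1+\dots+\sigma(E)\alpha_n\bigr)=\{0\}$. \end{itemize} If either (i) $b_1=0$, or (ii) $b_0=0$ and $\delta=0$, then the set $\{\alpha_1\Xi,\dots,\alpha_n\Xi\}$ freely generates a free (associative, unital) $k$-subalgebra in $D(X;\sigma,\delta)$.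
   Context: A $\sigma$-derivation of $D$ is a $k$-linear map $\delta\colon D\to D$ satisfying $\delta(\alpha\beta)=\sigma(\alpha)\delta(\beta)+\delta(\alpha)\beta$ for all $\alpha,\beta\in D$. $D[X;\sigma,\delta]$ denotes the skew polynomial ring in the indeterminate $X$, with coefficients written on the left, such that $X\alpha=\sigma(\alpha)X+\delta(\alpha)$ for all $\alpha\in D$, and $D(X;\sigma,\delta)$ denotes its (Ore) division ring of fractions. The map $\psi$ is again a $\sigma$-derivation. *)

theory Defs
  imports "HOL-Algebra.UnivPoly" "HOL-Algebra.QuotRing"
begin

section \<open>Division algebras, automorphisms and skew derivations\<close>

locale skew_field = ring +
  assumes one_not_zero: "\<one> \<noteq> \<zero>"
    and Units_eq: "Units R = carrier R - {\<zero>}"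

text \<open>The library locale \<^locale>\<open>algebra\<close> requires the algebra to be commutative.\<close>

locale division_algebra = K?: field K + module K D + D?: skew_field D for K and D (structure) +
  assumes smult_mult_left:
      "\<lbrakk>a \<in> carrier K; x \<in> carrier D; y \<in> carrier D\<rbrakk> \<Longrightarrow>
        (a \<odot>\<^bsub>D\<^esub> x) \<otimes>\<^bsub>D\<^esub> y = a \<odot>\<^bsub>D\<^esub> (x \<otimes>\<^bsub>D\<^esub> y)"
    and smult_mult_right:
      "\<lbrakk>a \<in> carrier K; x \<in> carrier D; y \<in> carrier D\<rbrakk> \<Longrightarrow>
        x \<otimes>\<^bsub>D\<^esub> (a \<odot>\<^bsub>D\<^esub> y) = a \<odot>\<^bsub>D\<^esub> (x \<otimes>\<^bsub>D\<^esub> y)"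

definition k_linear ::
  "('k, 'a) ring_scheme \<Rightarrow> ('k, 'd, 'm) module_scheme \<Rightarrow> ('d \<Rightarrow> 'd) \<Rightarrow> bool" where
  "k_linear K D h \<longleftrightarrow> h \<in> carrier D \<rightarrow> carrier D \<and>
    (\<forall>x \<in> carrier D. \<forall>y \<in> carrier D. h (x \<oplus>\<^bsub>D\<^esub> y) = h x \<oplus>\<^bsub>D\<^esub> h y) \<and>
    (\<forall>c \<in> carrier K. \<forall>x \<in> carrier D. h (c \<odot>\<^bsub>D\<^esub> x) = c \<odot>\<^bsub>D\<^esub> h x)"

definition k_automorphism ::
  "('k, 'a) ring_scheme \<Rightarrow> ('k, 'd, 'm) module_scheme \<Rightarrow> ('d \<Rightarrow> 'd) \<Rightarrow> bool" where
  "k_automorphism K D \<sigma> \<longleftrightarrow> \<sigma> \<in> ring_iso D D \<and> k_linear K D \<sigma>"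

definition sigma_derivation ::
  "('k, 'a) ring_scheme \<Rightarrow> ('k, 'd, 'm) module_scheme \<Rightarrow> ('d \<Rightarrow> 'd) \<Rightarrow> ('d \<Rightarrow> 'd) \<Rightarrow> bool" where
  "sigma_derivation K D \<sigma> \<delta> \<longleftrightarrow> k_linear K D \<delta> \<and>
    (\<forall>x \<in> carrier D. \<forall>y \<in> carrier D.
      \<delta> (x \<otimes>\<^bsub>D\<^esub> y) = \<sigma> x \<otimes>\<^bsub>D\<^esub> \<delta> y \<oplus>\<^bsub>D\<^esub> \<delta> x \<otimes>\<^bsub>D\<^esub> y)"

section \<open>The skew polynomial ring and its division ring of fractions\<close>

text \<open>
  Polynomials are finitely supported coefficient sequences, as in \<^const>\<open>UP\<close>, where \<open>p\<close> stands for
  the sum of the \<open>p i X\<^sup>i\<close> with coefficients on the left. Since \<open>X a = \<sigma>(a) X + \<delta>(a)\<close>,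
  left multiplication by \<open>X\<close> maps \<open>q\<close> to the sum of the \<open>\<sigma>(q j) X\<^bsup>j+1\<^esup> + \<delta>(q j) X\<^sup>j\<close>,
  and \<open>p q\<close> is the sum of the \<open>p i (X\<^sup>i q)\<close>.
\<close>

definition left_mult_X ::
  "('d, 'm) ring_scheme \<Rightarrow> ('d \<Rightarrow> 'd) \<Rightarrow> ('d \<Rightarrow> 'd) \<Rightarrow> (nat \<Rightarrow> 'd) \<Rightarrow> nat \<Rightarrow> 'd" where
  "left_mult_X D \<sigma> \<delta> q =
    (\<lambda>j. (if j = 0 then \<zero>\<^bsub>D\<^esub> else \<sigma> (q (j - 1))) \<oplus>\<^bsub>D\<^esub> \<delta> (q j))"

definition skew_mult ::
  "('d, 'm) ring_scheme \<Rightarrow> ('d \<Rightarrow> 'd) \<Rightarrow> ('d \<Rightarrow> 'd) \<Rightarrow> (nat \<Rightarrow> 'd) \<Rightarrow> (nat \<Rightarrow> 'd) \<Rightarrow> nat \<Rightarrow> 'd" where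
  "skew_mult D \<sigma> \<delta> p q =
    (\<lambda>j. \<Oplus>\<^bsub>D\<^esub>i \<in> {i. p i \<noteq> \<zero>\<^bsub>D\<^esub>}. p i \<otimes>\<^bsub>D\<^esub> (left_mult_X D \<sigma> \<delta> ^^ i) q j)"

definition skew_poly ::
  "('d, 'm) ring_scheme \<Rightarrow> ('d \<Rightarrow> 'd) \<Rightarrow> ('d \<Rightarrow> 'd) \<Rightarrow> ('d, nat \<Rightarrow> 'd) up_ring" where
  "skew_poly D \<sigma> \<delta> = (UP D)\<lparr>mult := skew_mult D \<sigma> \<delta>\<rparr>"

lemma skew_poly_commutation:
  assumes "division_algebra K D" "k_automorphism K D \<sigma>" "sigma_derivation K D \<sigma> \<delta>" "x \<in> carrier D"
  defines "R \<equiv> skew_poly D \<sigma> \<delta>"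
  shows "monom R \<one>\<^bsub>D\<^esub> 1 \<otimes>\<^bsub>R\<^esub> monom R x 0 =
    monom R (\<sigma> x) 1 \<oplus>\<^bsub>R\<^esub> monom R (\<delta> x) 0"
proof -
  interpret D: skew_field D
    using assms(1) by (simp add: division_algebra_def)
  have s: "\<sigma> y \<in> carrier D" "\<delta> y \<in> carrier D" if "y \<in> carrier D" for y
    using assms(2,3) that by (auto simp: k_automorphism_def sigma_derivation_def k_linear_def)
  have z: "h \<zero>\<^bsub>D\<^esub> = \<zero>\<^bsub>D\<^esub>" if "k_linear K D h" for h
  proof -
    have h: "h \<zero>\<^bsub>D\<^esub> \<in> carrier D" "h (\<zero>\<^bsub>D\<^esub> \<oplus>\<^bsub>D\<^esub> \<zero>\<^bsub>D\<^esub>) = h \<zero>\<^bsub>D\<^esub> \<oplus>\<^bsub>D\<^esub> h \<zero>\<^bsub>D\<^esub>"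
      using that D.zero_closed unfolding k_linear_def by blast+
    then show ?thesis by simp
  qed
  have z': "\<sigma> \<zero>\<^bsub>D\<^esub> = \<zero>\<^bsub>D\<^esub>" "\<delta> \<zero>\<^bsub>D\<^esub> = \<zero>\<^bsub>D\<^esub>"
    using assms(2,3) z by (auto simp: k_automorphism_def sigma_derivation_def)
  have m: "(\<lambda>i. if i = k then y else \<zero>\<^bsub>D\<^esub>) \<in> up D" if "y \<in> carrier D" for y and k :: nat
    using that by (auto simp: up_def intro!: exI[of _ k])
  have supp: "{i. (if i = Suc 0 then \<one>\<^bsub>D\<^esub> else \<zero>\<^bsub>D\<^esub>) \<noteq> \<zero>\<^bsub>D\<^esub>} = {Suc 0}"
    using D.one_not_zero by auto
  show ?thesis
    unfolding R_def skew_poly_def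
    using assms(4) s z' m[OF s(1), of x 1] m[OF s(2), of x 0] supp
    by (auto simp: UP_def skew_mult_def left_mult_X_def fun_eq_iff)
qed

text \<open>
  A division ring of (right) fractions of \<open>R\<close>, with embedding \<open>\<iota>\<close>; it is unique up to an isomorphism
  over \<open>R\<close>. As \<open>\<sigma>\<close> is bijective, the skew polynomial ring is a left and right Ore domain, so
  its left and right division rings of fractions coincide.
\<close>

definition division_ring_of_fractions ::
  "('r, 'm) ring_scheme \<Rightarrow> ('q, 'n) ring_scheme \<Rightarrow> ('r \<Rightarrow> 'q) \<Rightarrow> bool" where
  "division_ring_of_fractions R Q \<iota> \<longleftrightarrow>
    skew_field Q \<and> \<iota> \<in> ring_hom R Q \<and> inj_on \<iota> (carrier R) \<and>
    (\<forall>z \<in> carrier Q. \<exists>p \<in> carrier R. \<exists>s \<in> carrier R - {\<zero>\<^bsub>R\<^esub>}.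
      z = \<iota> p \<otimes>\<^bsub>Q\<^esub> inv\<^bsub>Q\<^esub> (\<iota> s))"

definition coeff_embed ::
  "('d, nat \<Rightarrow> 'd) up_ring \<Rightarrow> ((nat \<Rightarrow> 'd) \<Rightarrow> 'q) \<Rightarrow> 'd \<Rightarrow> 'q" where
  "coeff_embed R \<iota> x = \<iota> (monom R x 0)"

text \<open>The structure map of the algebra of fractions over \<open>k\<close>.\<close>

definition scalar_embed ::
  "('k, 'd, 'm) module_scheme \<Rightarrow> ('d, nat \<Rightarrow> 'd) up_ring \<Rightarrow> ((nat \<Rightarrow> 'd) \<Rightarrow> 'q) \<Rightarrow> 'k \<Rightarrow> 'q" where
  "scalar_embed D R \<iota> c = coeff_embed R \<iota> (c \<odot>\<^bsub>D\<^esub> \<one>\<^bsub>D\<^esub>)"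

text \<open>The polynomial \<open>a\<^sub>0 + a\<^sub>1 X\<close> with coefficients in \<open>k\<close>.\<close>

definition linear_poly ::
  "('k, 'd, 'm) module_scheme \<Rightarrow> ('d, nat \<Rightarrow> 'd) up_ring \<Rightarrow> 'k \<Rightarrow> 'k \<Rightarrow> nat \<Rightarrow> 'd" where
  "linear_poly D R a\<^sub>0 a\<^sub>1 =
    monom R (a\<^sub>0 \<odot>\<^bsub>D\<^esub> \<one>\<^bsub>D\<^esub>) 0 \<oplus>\<^bsub>R\<^esub> monom R (a\<^sub>1 \<odot>\<^bsub>D\<^esub> \<one>\<^bsub>D\<^esub>) 1"

section \<open>Linear independence and free generation\<close>

definition left_span ::
  "('d, 'm) ring_scheme \<Rightarrow> 'd set \<Rightarrow> 'i set \<Rightarrow> ('i \<Rightarrow> 'd) \<Rightarrow> 'd set" where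
  "left_span D S I x = {\<Oplus>\<^bsub>D\<^esub>i \<in> I. c i \<otimes>\<^bsub>D\<^esub> x i | c. c \<in> I \<rightarrow> S}"

definition left_lin_indep ::
  "('d, 'm) ring_scheme \<Rightarrow> 'd set \<Rightarrow> 'i set \<Rightarrow> ('i \<Rightarrow> 'd) \<Rightarrow> bool" where
  "left_lin_indep D S I x \<longleftrightarrow>
    (\<forall>c \<in> I \<rightarrow> S. (\<Oplus>\<^bsub>D\<^esub>i \<in> I. c i \<otimes>\<^bsub>D\<^esub> x i) = \<zero>\<^bsub>D\<^esub> \<longrightarrow> (\<forall>i \<in> I. c i = \<zero>\<^bsub>D\<^esub>))"

text \<open>
  The free associative unital algebra over \<open>K\<close> on letters \<open>I\<close> has the words in \<open>I\<close> (the free monoid)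
  as a basis; its elements are the finitely supported coefficient functions on words.
\<close>

definition free_algebra :: "('k, 'a) ring_scheme \<Rightarrow> 'i set \<Rightarrow> ('i list \<Rightarrow> 'k) set" where
  "free_algebra K I =
    {p. p \<in> UNIV \<rightarrow> carrier K \<and> finite {w. p w \<noteq> \<zero>\<^bsub>K\<^esub>} \<and> {w. p w \<noteq> \<zero>\<^bsub>K\<^esub>} \<subseteq> lists I}"

text \<open>
  The homomorphism from the free algebra to \<open>Q\<close> that sends each letter \<open>i\<close> to \<open>x i\<close>, where
  \<open>\<phi>\<close> is the structure map of the algebra \<open>Q\<close>.
\<close>

definition free_eval ::
  "('k, 'a) ring_scheme \<Rightarrow> ('q, 'n) ring_scheme \<Rightarrow> ('k \<Rightarrow> 'q) \<Rightarrow> ('i \<Rightarrow> 'q) \<Rightarrow> ('i list \<Rightarrow> 'k) \<Rightarrow> 'q" where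
  "free_eval K Q \<phi> x p =
    (\<Oplus>\<^bsub>Q\<^esub>w \<in> {w. p w \<noteq> \<zero>\<^bsub>K\<^esub>}. \<phi> (p w) \<otimes>\<^bsub>Q\<^esub> foldr (\<otimes>\<^bsub>Q\<^esub>) (map x w) \<one>\<^bsub>Q\<^esub>)"

definition freely_generates ::
  "('k, 'a) ring_scheme \<Rightarrow> ('q, 'n) ring_scheme \<Rightarrow> ('k \<Rightarrow> 'q) \<Rightarrow> 'i set \<Rightarrow> ('i \<Rightarrow> 'q) \<Rightarrow> bool" where
  "freely_generates K Q \<phi> I x \<longleftrightarrow>
    x \<in> I \<rightarrow> carrier Q \<and> inj_on (free_eval K Q \<phi> x) (free_algebra K I)"

end

theory Submission
  imports Defs
begin

text \<open>
  Put \<open>Y = f\<^sup>-\<^sup>1\<close>. From \<open>f x = \<sigma>(x) f + \<psi>(x)\<close> we get \<open>f (x Y) = \<sigma>(x) + \<psi>(x) Y\<close> for \<open>x\<close> in \<open>D\<close>, and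
  \<open>\<Xi> = p + q Y\<close> with scalars \<open>p\<close> and \<open>q \<noteq> 0\<close>. Consider the words \<open>w\<close> in the \<open>\<alpha>\<^sub>i \<Xi>\<close>. The elements \<open>Y w\<close>
  are left linearly independent over \<open>D\<close> even modulo the polynomials: in a shortest relation
  with a coefficient \<open>1\<close> on a longest word, left multiplication by \<open>f\<close> kills that coefficient and
  sends \<open>c Y \<alpha>\<^sub>i \<Xi> w\<close> to \<open>\<psi>(c) Y \<alpha>\<^sub>i \<Xi> w + \<sigma>(c) \<alpha>\<^sub>i q Y w\<close> plus shorter terms. By minimality the top coefficients
  lie in \<open>E\<close>, and comparing coefficients of \<open>Y w\<close> puts a nontrivial \<open>\<sigma>(E)\<close>-combination of the \<open>\<alpha>\<^sub>i\<close>
  in the image of \<open>\<psi>\<close>. A scalar relation between the words becomes one between the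
  \<open>Y w\<close> after left multiplication by \<open>Y\<close>.
\<close>

section \<open>Independence of words over the coefficient ring\<close>

text \<open>
  Here \<open>\<phi>\<close> embeds the coefficients, \<open>S\<close> is the set of polynomials, \<open>Y\<close> is the inverse of \<open>f\<close>, and the
  letters are the \<open>\<alpha>\<^sub>i (p + q Y)\<close>.
\<close>

locale skew_inverse =
  ring_hom_ring D Q \<phi> + D: skew_field D
  for D :: "('d, 'm) ring_scheme" and Q :: "('q, 'n) ring_scheme" (structure) and \<phi> +
  fixes \<sigma> \<psi> :: "'d \<Rightarrow> 'd" and f Y :: 'q and S :: "'q set"
    and I :: "'i set" and \<alpha> :: "'i \<Rightarrow> 'd" and p q :: 'd
  assumes sigma_closed: "x \<in> carrier D \<Longrightarrow> \<sigma> x \<in> carrier D"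
    and psi_closed: "x \<in> carrier D \<Longrightarrow> \<psi> x \<in> carrier D"
    and sigma_one: "\<sigma> \<one>\<^bsub>D\<^esub> = \<one>\<^bsub>D\<^esub>"
    and sigma_zero: "\<sigma> \<zero>\<^bsub>D\<^esub> = \<zero>\<^bsub>D\<^esub>"
    and psi_one: "\<psi> \<one>\<^bsub>D\<^esub> = \<zero>\<^bsub>D\<^esub>"
    and psi_zero: "\<psi> \<zero>\<^bsub>D\<^esub> = \<zero>\<^bsub>D\<^esub>"
    and f_closed: "f \<in> carrier Q"
    and Y_closed: "Y \<in> carrier Q"
    and f_Y: "f \<otimes> Y = \<one>"
    and f_commute: "x \<in> carrier D \<Longrightarrow> f \<otimes> \<phi> x = \<phi> (\<sigma> x) \<otimes> f \<oplus> \<phi> (\<psi> x)"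
    and S_subset: "S \<subseteq> carrier Q"
    and S_one: "\<one> \<in> S"
    and S_add: "s \<in> S \<Longrightarrow> t \<in> S \<Longrightarrow> s \<oplus> t \<in> S"
    and S_lmult: "x \<in> carrier D \<Longrightarrow> s \<in> S \<Longrightarrow> \<phi> x \<otimes> s \<in> S"
    and S_f: "s \<in> S \<Longrightarrow> f \<otimes> s \<in> S"
    and Y_notin_S: "x \<in> carrier D \<Longrightarrow> \<phi> x \<otimes> Y \<in> S \<Longrightarrow> x = \<zero>\<^bsub>D\<^esub>"
    and I_finite: "finite I"
    and alpha_closed: "\<alpha> \<in> I \<rightarrow> carrier D"
    and p_closed: "p \<in> carrier D"
    and q_closed: "q \<in> carrier D"
    and psi_sum_eq: "c \<in> I \<rightarrow> carrier D \<Longrightarrow> (\<And>i. i \<in> I \<Longrightarrow> \<psi> (c i) = \<zero>\<^bsub>D\<^esub>) \<Longrightarrow>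
      x \<in> carrier D \<Longrightarrow> (\<Oplus>\<^bsub>D\<^esub>i\<in>I. \<sigma> (c i) \<otimes>\<^bsub>D\<^esub> (\<alpha> i \<otimes>\<^bsub>D\<^esub> q)) = \<psi> x \<Longrightarrow>
      i \<in> I \<Longrightarrow> c i = \<zero>\<^bsub>D\<^esub>"
begin

section \<open>Words, layers and the filtration by word length\<close>

definition words :: "nat \<Rightarrow> 'i list set" where
  "words m = {w. set w \<subseteq> I \<and> length w = m}"

definition letter :: "'i \<Rightarrow> 'q" where
  "letter i = \<phi> (\<alpha> i) \<otimes> (\<phi> p \<oplus> \<phi> q \<otimes> Y)"

definition word_eval :: "'i list \<Rightarrow> 'q" where
  "word_eval w = foldr (\<otimes>) (map letter w) \<one>"

definition layer :: "nat \<Rightarrow> ('i list \<Rightarrow> 'd) \<Rightarrow> 'q" where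
  "layer m \<beta> = (\<Oplus>w\<in>words m. \<phi> (\<beta> w) \<otimes> (Y \<otimes> word_eval w))"

text \<open>The combinations that remain when \<open>f\<close> cancels the leading \<open>Y\<close>
  of a layer.\<close>

definition word_layer :: "nat \<Rightarrow> ('i list \<Rightarrow> 'd) \<Rightarrow> 'q" where
  "word_layer m \<beta> = (\<Oplus>w\<in>words m. \<phi> (\<beta> w) \<otimes> word_eval w)"

text \<open>
  \<open>layer m \<beta>\<close> is a \<open>D\<close>-combination of the \<open>Y w\<close> for the words \<open>w\<close> of length exactly \<open>m\<close>, and
  \<open>lower m\<close> consists of the \<open>D\<close>-combinations for words of length less than \<open>m\<close>, modulo \<open>S\<close>.
\<close>

primrec lower :: "nat \<Rightarrow> 'q set" where
  "lower 0 = S"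
| "lower (Suc m) = {layer m \<beta> \<oplus> x |\<beta> x. \<beta> \<in> words m \<rightarrow> carrier D \<and> x \<in> lower m}"

lemmas closed [simp] = sigma_closed psi_closed f_closed Y_closed p_closed q_closed
  funcset_mem[OF alpha_closed]

lemma finite_words [simp]: "finite (words m)"
  unfolding words_def by (rule finite_lists_length_eq[OF I_finite])

lemma words_0: "words 0 = {[]}"
  by (auto simp: words_def)

lemma words_Suc: "words (Suc m) = (\<Union>w\<in>words m. (\<lambda>i. i # w) ` I)"
proof -
  have "w \<in> words (Suc m) \<longleftrightarrow> (\<exists>i\<in>I. \<exists>v\<in>words m. w = i # v)" for w
    by (cases w) (auto simp: words_def)
  then show ?thesis by blast
qed

lemma Cons_words: "i \<in> I \<Longrightarrow> w \<in> words m \<Longrightarrow> i # w \<in> words (Suc m)"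
  by (auto simp: words_def)

lemma letter_closed: "i \<in> I \<Longrightarrow> letter i \<in> carrier Q"
  by (simp add: letter_def)

lemma word_eval_Nil [simp]: "word_eval [] = \<one>"
  and word_eval_Cons: "word_eval (i # w) = letter i \<otimes> word_eval w"
  by (simp_all add: word_eval_def)

lemma word_eval_closed: "set w \<subseteq> I \<Longrightarrow> word_eval w \<in> carrier Q"
  by (induction w) (auto simp: word_eval_Cons letter_closed)

lemma word_eval_closed' [simp]: "w \<in> words m \<Longrightarrow> word_eval w \<in> carrier Q"
  by (simp add: word_eval_closed words_def)

text \<open>A letter is \<open>\<alpha> i\<close> times \<open>p\<close> plus
  \<open>\<alpha> i\<close> times \<open>q Y\<close>, so removing the first letter of a word leaves
  \<open>Y\<close> times the tail plus the tail itself. The new coefficients stay on the left, hence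
  nothing has to be moved past \<open>Y\<close>.\<close>

lemma phi_letter:
  assumes "i \<in> I" "x \<in> carrier D" "u \<in> carrier Q"
  shows "\<phi> x \<otimes> (letter i \<otimes> u) =
    \<phi> (x \<otimes>\<^bsub>D\<^esub> (\<alpha> i \<otimes>\<^bsub>D\<^esub> q)) \<otimes> (Y \<otimes> u) \<oplus> \<phi> (x \<otimes>\<^bsub>D\<^esub> (\<alpha> i \<otimes>\<^bsub>D\<^esub> p)) \<otimes> u"
proof -
  have "\<phi> (\<alpha> i) \<in> carrier Q" using assms by simp
  then show ?thesis using assms
    by (simp add: letter_def S.l_distr S.r_distr S.m_assoc S.add.m_comm)
qed

section \<open>Layers as left combinations with coefficients in \<open>D\<close>\<close>

lemma layer_closed [simp]: "\<beta> \<in> words m \<rightarrow> carrier D \<Longrightarrow> layer m \<beta> \<in> carrier Q"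
  unfolding layer_def by (rule S.finsum_closed) (auto simp: Pi_def)

lemma layer_add:
  assumes "\<beta> \<in> words m \<rightarrow> carrier D" "\<gamma> \<in> words m \<rightarrow> carrier D"
  shows "layer m \<beta> \<oplus> layer m \<gamma> = layer m (\<lambda>w. \<beta> w \<oplus>\<^bsub>D\<^esub> \<gamma> w)"
proof -
  have "layer m (\<lambda>w. \<beta> w \<oplus>\<^bsub>D\<^esub> \<gamma> w) =
    (\<Oplus>w\<in>words m. \<phi> (\<beta> w) \<otimes> (Y \<otimes> word_eval w) \<oplus> \<phi> (\<gamma> w) \<otimes> (Y \<otimes> word_eval w))"
    unfolding layer_def
    by (rule S.finsum_cong') (use assms in \<open>auto simp: Pi_def S.l_distr\<close>)
  then show ?thesis
    unfolding layer_def by (subst (asm) S.finsum_addf) (use assms in \<open>auto simp: Pi_def\<close>)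
qed

lemma layer_lmult:
  assumes "\<beta> \<in> words m \<rightarrow> carrier D" "x \<in> carrier D"
  shows "\<phi> x \<otimes> layer m \<beta> = layer m (\<lambda>w. x \<otimes>\<^bsub>D\<^esub> \<beta> w)"
  unfolding layer_def
  by (subst S.finsum_rdistr) (use assms in \<open>auto simp: Pi_def S.m_assoc intro!: S.finsum_cong'\<close>)

lemma layer_zero: "(\<And>w. w \<in> words m \<Longrightarrow> \<beta> w = \<zero>\<^bsub>D\<^esub>) \<Longrightarrow> layer m \<beta> = \<zero>"
  unfolding layer_def by (rule S.add.finprod_one_eqI) simp

lemma layer_single:
  assumes "w \<in> words m" "x \<in> carrier D"
  shows "layer m (\<lambda>v. if v = w then x else \<zero>\<^bsub>D\<^esub>) = \<phi> x \<otimes> (Y \<otimes> word_eval w)"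
proof -
  have "layer m (\<lambda>v. if v = w then x else \<zero>\<^bsub>D\<^esub>) =
      (\<Oplus>v\<in>words m. if v = w then \<phi> x \<otimes> (Y \<otimes> word_eval v) else \<zero>)"
    unfolding layer_def
    by (rule S.finsum_cong') (use assms in \<open>auto simp: Pi_def\<close>)
  also have "\<dots> = \<phi> x \<otimes> (Y \<otimes> word_eval w)"
    by (rule S.add.finprod_singleton_swap) (use assms in auto)
  finally show ?thesis .
qed

lemma lower_closed: "x \<in> lower m \<Longrightarrow> x \<in> carrier Q"
  by (induction m arbitrary: x) (use S_subset in auto)

text \<open>With \<open>lower_add\<close> this makes \<open>lower m\<close> a left
  \<open>D\<close>-submodule of \<open>Q\<close>, so a relation modulo \<open>lower m\<close> can be
  rescaled to have a coefficient 1.\<close>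

lemma lower_lmult: "x \<in> lower m \<Longrightarrow> y \<in> carrier D \<Longrightarrow> \<phi> y \<otimes> x \<in> lower m"
proof (induction m arbitrary: x)
  case 0
  then show ?case by (simp add: S_lmult)
next
  case (Suc m)
  then obtain \<beta> z where x: "x = layer m \<beta> \<oplus> z" and \<beta>: "\<beta> \<in> words m \<rightarrow> carrier D"
    and z: "z \<in> lower m" by auto
  have "\<phi> y \<otimes> x = layer m (\<lambda>w. y \<otimes>\<^bsub>D\<^esub> \<beta> w) \<oplus> \<phi> y \<otimes> z"
    using x \<beta> z Suc.prems by (simp add: S.r_distr lower_closed layer_lmult)
  moreover have "(\<lambda>w. y \<otimes>\<^bsub>D\<^esub> \<beta> w) \<in> words m \<rightarrow> carrier D"
    using \<beta> Suc.prems by (auto simp: Pi_def)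
  ultimately show ?case using Suc.IH[OF z Suc.prems(2)] by auto
qed

lemma lower_add: "x \<in> lower m \<Longrightarrow> y \<in> lower m \<Longrightarrow> x \<oplus> y \<in> lower m"
proof (induction m arbitrary: x y)
  case 0
  then show ?case by (simp add: S_add)
next
  case (Suc m)
  then obtain \<beta> z where x: "x = layer m \<beta> \<oplus> z" and \<beta>: "\<beta> \<in> words m \<rightarrow> carrier D"
    and z: "z \<in> lower m" by auto
  from Suc obtain \<gamma> z' where y: "y = layer m \<gamma> \<oplus> z'" and \<gamma>: "\<gamma> \<in> words m \<rightarrow> carrier D"
    and z': "z' \<in> lower m" by auto
  have "x \<oplus> y = (layer m \<beta> \<oplus> layer m \<gamma>) \<oplus> (z \<oplus> z')"
    using x y \<beta> \<gamma> z z' by (simp add: lower_closed S.a_ac)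
  also have "layer m \<beta> \<oplus> layer m \<gamma> = layer m (\<lambda>w. \<beta> w \<oplus>\<^bsub>D\<^esub> \<gamma> w)"
    by (rule layer_add[OF \<beta> \<gamma>])
  finally have "x \<oplus> y = layer m (\<lambda>w. \<beta> w \<oplus>\<^bsub>D\<^esub> \<gamma> w) \<oplus> (z \<oplus> z')" .
  moreover have "(\<lambda>w. \<beta> w \<oplus>\<^bsub>D\<^esub> \<gamma> w) \<in> words m \<rightarrow> carrier D"
    using \<beta> \<gamma> by auto
  ultimately show ?case using Suc.IH[OF z z'] by auto
qed

lemma lower_minus: "x \<in> lower m \<Longrightarrow> \<ominus> x \<in> lower m"
  using lower_lmult[of x m "\<ominus>\<^bsub>D\<^esub> \<one>\<^bsub>D\<^esub>"] by (simp add: S.l_minus lower_closed)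

lemma lower_zero: "\<zero> \<in> lower m"
proof -
  \<comment> \<open>\<open>lower m\<close> is nonempty since \<open>S\<close> contains 1;
    multiplying any element by the coefficient 0 then gives 0.\<close>
  have "\<exists>x. x \<in> lower m"
    by (induction m) (use S_one in \<open>auto intro: exI[of _ "\<lambda>_. \<zero>\<^bsub>D\<^esub>"]\<close>)
  then show ?thesis using lower_lmult[of _ m "\<zero>\<^bsub>D\<^esub>"] by (auto simp: lower_closed)
qed

lemma lower_minus_cancel: "x \<oplus> y \<in> lower m \<Longrightarrow> y \<in> lower m \<Longrightarrow> x \<in> carrier Q \<Longrightarrow> x \<in> lower m"
  using lower_add[of "x \<oplus> y" m "\<ominus> y"]
  by (simp add: lower_minus S.a_assoc lower_closed S.r_neg)

lemma lower_Suc_I: "x \<in> lower m \<Longrightarrow> x \<in> lower (Suc m)"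
  using layer_zero[of m "\<lambda>_. \<zero>\<^bsub>D\<^esub>"] by (force simp: lower_closed)

lemma lower_mono: "m \<le> n \<Longrightarrow> x \<in> lower m \<Longrightarrow> x \<in> lower n"
  by (induction rule: dec_induct) (auto simp: lower_Suc_I simp del: lower.simps)

lemma layer_in_lower: "\<beta> \<in> words m \<rightarrow> carrier D \<Longrightarrow> layer m \<beta> \<in> lower (Suc m)"
  using lower_zero[of m] by (auto intro!: exI[of _ \<beta>] exI[of _ \<zero>])

lemma term_in_lower:
  assumes "w \<in> words m" "x \<in> carrier D"
  shows "\<phi> x \<otimes> (Y \<otimes> word_eval w) \<in> lower (Suc m)"
  using layer_in_lower[of "\<lambda>v. if v = w then x else \<zero>\<^bsub>D\<^esub>" m] layer_single[OF assms] assms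
  by (auto simp: Pi_def simp del: lower.simps)

lemma lower_finsum:
  "finite A \<Longrightarrow> (\<And>a. a \<in> A \<Longrightarrow> g a \<in> lower m) \<Longrightarrow> (\<Oplus>a\<in>A. g a) \<in> lower m"
proof (induction A rule: finite_induct)
  case (insert a A)
  then have "g a \<in> lower m" "g \<in> A \<rightarrow> carrier Q" by (auto intro: lower_closed)
  with insert show ?case
    by (subst S.finsum_insert) (auto intro: lower_add lower_closed)
qed (simp add: lower_zero)

text \<open>Without the leading \<open>Y\<close> a word counts one step lower: expanding its first
  letter gives \<open>Y\<close> times a word of length \<open>m - 1\<close>, which is in
  \<open>lower m\<close>, and a shorter word. At length 0 only a coefficient is left, which lies in
  \<open>S\<close>.\<close>

lemma word_in_lower: "w \<in> words m \<Longrightarrow> x \<in> carrier D \<Longrightarrow> \<phi> x \<otimes> word_eval w \<in> lower m"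
proof (induction m arbitrary: w x)
  case 0
  then show ?case using S_lmult[OF _ S_one] by (simp add: words_0)
next
  case (Suc m)
  then obtain i v where w: "w = i # v" "i \<in> I" "v \<in> words m" by (auto simp: words_Suc)
  have "\<phi> x \<otimes> word_eval w = \<phi> (x \<otimes>\<^bsub>D\<^esub> (\<alpha> i \<otimes>\<^bsub>D\<^esub> q)) \<otimes> (Y \<otimes> word_eval v)
      \<oplus> \<phi> (x \<otimes>\<^bsub>D\<^esub> (\<alpha> i \<otimes>\<^bsub>D\<^esub> p)) \<otimes> word_eval v"
    unfolding w(1) word_eval_Cons by (rule phi_letter) (use w Suc.prems in auto)
  moreover have "\<phi> (x \<otimes>\<^bsub>D\<^esub> (\<alpha> i \<otimes>\<^bsub>D\<^esub> q)) \<otimes> (Y \<otimes> word_eval v) \<in> lower (Suc m)"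
    by (rule term_in_lower) (use w Suc.prems in auto)
  moreover have "\<phi> (x \<otimes>\<^bsub>D\<^esub> (\<alpha> i \<otimes>\<^bsub>D\<^esub> p)) \<otimes> word_eval v \<in> lower (Suc m)"
    by (rule lower_Suc_I, rule Suc.IH) (use w Suc.prems in auto)
  ultimately show ?case by (simp add: lower_add del: lower.simps)
qed

section \<open>Left multiplication by \<open>f\<close> and the resulting descent in word
  length\<close>

lemma word_layer_in_lower: "\<beta> \<in> words m \<rightarrow> carrier D \<Longrightarrow> word_layer m \<beta> \<in> lower m"
  unfolding word_layer_def by (rule lower_finsum) (auto intro: word_in_lower)

text \<open>Moving \<open>f\<close> past a coefficient \<open>x\<close> gives
  \<open>\<sigma> x\<close> followed by \<open>f\<close>, which cancels the \<open>Y\<close>, and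
  \<open>\<psi> x\<close>, which leaves the \<open>Y\<close> in place.\<close>

lemma f_layer:
  assumes "\<beta> \<in> words m \<rightarrow> carrier D"
  shows "f \<otimes> layer m \<beta> = layer m (\<lambda>w. \<psi> (\<beta> w)) \<oplus> word_layer m (\<lambda>w. \<sigma> (\<beta> w))"
proof -
  have fY: "f \<otimes> (Y \<otimes> u) = u" if "u \<in> carrier Q" for u
    using that by (simp add: S.m_assoc[symmetric] f_Y)
  have *: "f \<otimes> (\<phi> x \<otimes> (Y \<otimes> u)) = \<phi> (\<psi> x) \<otimes> (Y \<otimes> u) \<oplus> \<phi> (\<sigma> x) \<otimes> u"
    if "x \<in> carrier D" "u \<in> carrier Q" for x u
  proof -
    have "f \<otimes> (\<phi> x \<otimes> (Y \<otimes> u)) = (f \<otimes> \<phi> x) \<otimes> (Y \<otimes> u)"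
      using that by (simp add: S.m_assoc)
    also have "\<dots> = \<phi> (\<sigma> x) \<otimes> (f \<otimes> (Y \<otimes> u)) \<oplus> \<phi> (\<psi> x) \<otimes> (Y \<otimes> u)"
      using that by (simp add: f_commute S.l_distr S.m_assoc)
    finally show ?thesis using that by (simp add: fY S.add.m_comm)
  qed
  have "f \<otimes> layer m \<beta> = (\<Oplus>w\<in>words m. f \<otimes> (\<phi> (\<beta> w) \<otimes> (Y \<otimes> word_eval w)))"
    unfolding layer_def by (rule S.finsum_rdistr) (use assms in \<open>auto simp: Pi_def\<close>)
  also have "\<dots> = (\<Oplus>w\<in>words m.
      \<phi> (\<psi> (\<beta> w)) \<otimes> (Y \<otimes> word_eval w) \<oplus> \<phi> (\<sigma> (\<beta> w)) \<otimes> word_eval w)"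
    by (rule S.finsum_cong') (use assms in \<open>auto simp: Pi_def *\<close>)
  also have "\<dots> = layer m (\<lambda>w. \<psi> (\<beta> w)) \<oplus> word_layer m (\<lambda>w. \<sigma> (\<beta> w))"
    unfolding layer_def word_layer_def
    by (subst S.finsum_addf) (use assms in \<open>auto simp: Pi_def\<close>)
  finally show ?thesis .
qed

text \<open>The words that lose their \<open>Y\<close> drop to a lower level, and \<open>S\<close>
  is stable under \<open>f\<close>. Hence \<open>f\<close> can be applied to a relation modulo
  \<open>lower m\<close>.\<close>

lemma f_lower: "x \<in> lower m \<Longrightarrow> f \<otimes> x \<in> lower m"
proof (induction m arbitrary: x)
  case 0
  then show ?case by (simp add: S_f)
next
  case (Suc m)
  then obtain \<beta> z where x: "x = layer m \<beta> \<oplus> z" and \<beta>: "\<beta> \<in> words m \<rightarrow> carrier D"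
    and z: "z \<in> lower m" by auto
  have "f \<otimes> x = layer m (\<lambda>w. \<psi> (\<beta> w)) \<oplus> word_layer m (\<lambda>w. \<sigma> (\<beta> w)) \<oplus> f \<otimes> z"
    using x \<beta> z by (simp add: S.r_distr lower_closed f_layer)
  moreover have "layer m (\<lambda>w. \<psi> (\<beta> w)) \<in> lower (Suc m)"
    by (rule layer_in_lower) (use \<beta> in \<open>auto simp: Pi_def\<close>)
  moreover have "word_layer m (\<lambda>w. \<sigma> (\<beta> w)) \<in> lower (Suc m)"
    by (rule lower_Suc_I, rule word_layer_in_lower) (use \<beta> in \<open>auto simp: Pi_def\<close>)
  ultimately show ?case using lower_Suc_I[OF Suc.IH[OF z]] by (simp add: lower_add del: lower.simps)
qed

text \<open>The words are grouped by their tails and the first letters expanded with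
  \<open>phi_letter\<close>. The coefficient of \<open>Y\<close> times a tail becomes a combination
  of the \<open>\<alpha> i\<close> times \<open>q\<close>, the shape required by
  \<open>psi_sum_eq\<close>.\<close>

lemma word_layer_Suc:
  assumes "\<beta> \<in> words (Suc m) \<rightarrow> carrier D"
  shows "word_layer (Suc m) \<beta> =
    layer m (\<lambda>w. \<Oplus>\<^bsub>D\<^esub>i\<in>I. \<beta> (i # w) \<otimes>\<^bsub>D\<^esub> (\<alpha> i \<otimes>\<^bsub>D\<^esub> q)) \<oplus>
    word_layer m (\<lambda>w. \<Oplus>\<^bsub>D\<^esub>i\<in>I. \<beta> (i # w) \<otimes>\<^bsub>D\<^esub> (\<alpha> i \<otimes>\<^bsub>D\<^esub> p))"
proof -
  have b: "\<beta> (i # w) \<in> carrier D" if "i \<in> I" "w \<in> words m" for i w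
    using assms that Cons_words by blast
  have *: "(\<Oplus>v\<in>(\<lambda>i. i # w) ` I. \<phi> (\<beta> v) \<otimes> word_eval v) =
      \<phi> (\<Oplus>\<^bsub>D\<^esub>i\<in>I. \<beta> (i # w) \<otimes>\<^bsub>D\<^esub> (\<alpha> i \<otimes>\<^bsub>D\<^esub> q)) \<otimes> (Y \<otimes> word_eval w) \<oplus>
      \<phi> (\<Oplus>\<^bsub>D\<^esub>i\<in>I. \<beta> (i # w) \<otimes>\<^bsub>D\<^esub> (\<alpha> i \<otimes>\<^bsub>D\<^esub> p)) \<otimes> word_eval w" (is "?l = _")
    if w: "w \<in> words m" for w
  proof -
    have "?l = (\<Oplus>i\<in>I. \<phi> (\<beta> (i # w)) \<otimes> (letter i \<otimes> word_eval w))"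
      by (subst S.finsum_reindex) (use b w in \<open>auto simp: word_eval_Cons letter_closed inj_on_def\<close>)
    also have "\<dots> = (\<Oplus>i\<in>I. \<phi> (\<beta> (i # w) \<otimes>\<^bsub>D\<^esub> (\<alpha> i \<otimes>\<^bsub>D\<^esub> q)) \<otimes> (Y \<otimes> word_eval w) \<oplus>
        \<phi> (\<beta> (i # w) \<otimes>\<^bsub>D\<^esub> (\<alpha> i \<otimes>\<^bsub>D\<^esub> p)) \<otimes> word_eval w)"
      by (rule S.finsum_cong', simp, use b w in force, rule phi_letter) (use b w in auto)
    also have "\<dots> = (\<Oplus>i\<in>I. \<phi> (\<beta> (i # w) \<otimes>\<^bsub>D\<^esub> (\<alpha> i \<otimes>\<^bsub>D\<^esub> q))) \<otimes> (Y \<otimes> word_eval w) \<oplus>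
        (\<Oplus>i\<in>I. \<phi> (\<beta> (i # w) \<otimes>\<^bsub>D\<^esub> (\<alpha> i \<otimes>\<^bsub>D\<^esub> p))) \<otimes> word_eval w"
      by (subst S.finsum_addf) (use b w I_finite in \<open>auto simp: Pi_def S.finsum_ldistr\<close>)
    finally show ?thesis
      using b w by (subst (1 2) hom_finsum) (auto simp: Pi_def o_def)
  qed
  have "word_layer (Suc m) \<beta> = (\<Oplus>w\<in>words m. \<Oplus>v\<in>(\<lambda>i. i # w) ` I. \<phi> (\<beta> v) \<otimes> word_eval v)"
    unfolding word_layer_def words_Suc
    by (rule S.add.finprod_UN_disjoint)
      (use b I_finite in \<open>auto simp: pairwise_def disjnt_def intro!: S.m_closed Cons_words word_eval_closed'\<close>)
  also have "\<dots> = (\<Oplus>w\<in>words m.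
      \<phi> (\<Oplus>\<^bsub>D\<^esub>i\<in>I. \<beta> (i # w) \<otimes>\<^bsub>D\<^esub> (\<alpha> i \<otimes>\<^bsub>D\<^esub> q)) \<otimes> (Y \<otimes> word_eval w) \<oplus>
      \<phi> (\<Oplus>\<^bsub>D\<^esub>i\<in>I. \<beta> (i # w) \<otimes>\<^bsub>D\<^esub> (\<alpha> i \<otimes>\<^bsub>D\<^esub> p)) \<otimes> word_eval w)"
    by (rule S.finsum_cong', simp, use b in \<open>auto intro!: R.finsum_closed S.m_closed S.a_closed hom_closed simp: *\<close>)
  also have "\<dots> = layer m (\<lambda>w. \<Oplus>\<^bsub>D\<^esub>i\<in>I. \<beta> (i # w) \<otimes>\<^bsub>D\<^esub> (\<alpha> i \<otimes>\<^bsub>D\<^esub> q)) \<oplus>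
    word_layer m (\<lambda>w. \<Oplus>\<^bsub>D\<^esub>i\<in>I. \<beta> (i # w) \<otimes>\<^bsub>D\<^esub> (\<alpha> i \<otimes>\<^bsub>D\<^esub> p))"
    unfolding layer_def word_layer_def
    by (subst S.finsum_addf) (use b in \<open>auto intro!: R.finsum_closed S.m_closed hom_closed\<close>)
  finally show ?thesis .
qed

lemma word_layer_closed: "\<beta> \<in> words m \<rightarrow> carrier D \<Longrightarrow> word_layer m \<beta> \<in> carrier Q"
  by (rule lower_closed, rule word_layer_in_lower)

text \<open>
  Multiplication by \<open>f\<close> applies \<open>\<psi>\<close> to the coefficients of the top layer. Once one of them is
  normalized to \<open>1\<close> it is killed, so all of them lie in the kernel of \<open>\<psi>\<close> by the induction on the
  number of nonzero coefficients. The next layer then violates the hypothesis on \<open>\<psi>\<close> and the \<open>\<alpha>\<^sub>i\<close>.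
\<close>

lemma layer_independent:
  "\<beta> \<in> words m \<rightarrow> carrier D \<Longrightarrow> layer m \<beta> \<in> lower m \<Longrightarrow> w \<in> words m \<Longrightarrow> \<beta> w = \<zero>\<^bsub>D\<^esub>"
proof (induction m arbitrary: \<beta> w)
  case 0
  \<comment> \<open>Only the empty word has length 0, and no nonzero \<open>D\<close>-multiple of
    \<open>Y\<close> lies in \<open>S = lower 0\<close>.\<close>
  then have "w = []" "\<beta> [] \<in> carrier D" by (auto simp: words_0)
  then show ?case using 0 Y_notin_S[of "\<beta> []"] by (simp add: layer_def words_0 Pi_def)
next
  case (Suc m)
  note outer_IH = Suc.IH
  from Suc.prems show ?case
  proof (induction "card {w \<in> words (Suc m). \<beta> w \<noteq> \<zero>\<^bsub>D\<^esub>}" arbitrary: \<beta> w rule: less_induct)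
    case (less \<beta> w)
    show ?case
    proof (rule ccontr)
      assume nz: "\<beta> w \<noteq> \<zero>\<^bsub>D\<^esub>"
      define x where "x = inv\<^bsub>D\<^esub> (\<beta> w)"
      have unit: "\<beta> w \<in> Units D" using nz less.prems by (auto simp: D.Units_eq)
      then have x: "x \<in> carrier D" "x \<otimes>\<^bsub>D\<^esub> \<beta> w = \<one>\<^bsub>D\<^esub>" by (simp_all add: x_def)
      define \<beta>' where "\<beta>' v = x \<otimes>\<^bsub>D\<^esub> \<beta> v" for v
      have \<beta>': "\<beta>' v \<in> carrier D" if "v \<in> words (Suc m)" for v
        using that less.prems x by (auto simp: \<beta>'_def)
      have \<beta>'w: "\<beta>' w = \<one>\<^bsub>D\<^esub>" by (simp add: \<beta>'_def x)
      have "layer (Suc m) \<beta>' \<in> lower (Suc m)"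
        using lower_lmult[OF less.prems(2) x(1)] layer_lmult[OF less.prems(1) x(1)]
        by (simp add: \<beta>'_def[abs_def])
      then obtain \<gamma> z where eq: "layer (Suc m) \<beta>' = layer m \<gamma> \<oplus> z"
        and \<gamma>: "\<gamma> \<in> words m \<rightarrow> carrier D" and z: "z \<in> lower m" by auto
      \<comment> \<open>\<open>A v\<close> and \<open>B v\<close> are the coefficients of
        \<open>Y\<close> times \<open>v\<close> and of \<open>v\<close> alone that come from the
        words \<open>i # v\<close> once \<open>f\<close> has cancelled their
        \<open>Y\<close>.\<close>
      define A where "A v = (\<Oplus>\<^bsub>D\<^esub>i\<in>I. \<sigma> (\<beta>' (i # v)) \<otimes>\<^bsub>D\<^esub> (\<alpha> i \<otimes>\<^bsub>D\<^esub> q))" for v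
      define B where "B v = (\<Oplus>\<^bsub>D\<^esub>i\<in>I. \<sigma> (\<beta>' (i # v)) \<otimes>\<^bsub>D\<^esub> (\<alpha> i \<otimes>\<^bsub>D\<^esub> p))" for v
      have A: "A v \<in> carrier D" and B: "B v \<in> carrier D" if "v \<in> words m" for v
        unfolding A_def B_def
        using that \<beta>' Cons_words by (auto intro!: R.finsum_closed R.m_closed)
      define t where "t = word_layer m (\<lambda>v. \<sigma> (\<gamma> v)) \<oplus> f \<otimes> z"
      have t: "t \<in> lower m" unfolding t_def
        by (intro lower_add f_lower z word_layer_in_lower) (use \<gamma> in \<open>auto simp: Pi_def\<close>)
      have wB: "word_layer m B \<in> lower m"
        by (rule word_layer_in_lower) (use B in auto)
      have c: "t \<in> carrier Q" "word_layer m B \<in> carrier Q" "z \<in> carrier Q" "layer m A \<in> carrier Q"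
          "layer m (\<lambda>v. \<psi> (\<gamma> v)) \<in> carrier Q" "layer m \<gamma> \<in> carrier Q"
          "layer (Suc m) (\<lambda>v. \<psi> (\<beta>' v)) \<in> carrier Q"
          "word_layer m (\<lambda>v. \<sigma> (\<gamma> v)) \<in> carrier Q"
        using t wB z A \<gamma> \<beta>' by (auto simp: Pi_def lower_closed intro!: layer_closed word_layer_closed)
      \<comment> \<open>Both sides of \<open>eq\<close> are multiplied by \<open>f\<close>; terms in
        \<open>lower m\<close> are collected in \<open>word_layer m B\<close> and
        \<open>t\<close>.\<close>
      have "f \<otimes> layer (Suc m) \<beta>' =
          layer (Suc m) (\<lambda>v. \<psi> (\<beta>' v)) \<oplus> (layer m A \<oplus> word_layer m B)"
        unfolding A_def B_def
        by (subst f_layer, use \<beta>' in force, subst word_layer_Suc) (use \<beta>' in auto)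
      moreover have "f \<otimes> (layer m \<gamma> \<oplus> z) = layer m (\<lambda>v. \<psi> (\<gamma> v)) \<oplus> t"
        using c \<gamma> by (simp add: S.r_distr f_layer t_def S.a_assoc)
      ultimately have main: "layer (Suc m) (\<lambda>v. \<psi> (\<beta>' v)) \<oplus> (layer m A \<oplus> word_layer m B) =
          layer m (\<lambda>v. \<psi> (\<gamma> v)) \<oplus> t"
        using eq by simp
      have psi0: "\<psi> (\<beta>' v) = \<zero>\<^bsub>D\<^esub>" if "v \<in> words (Suc m)" for v
      proof (rule less.hyps[OF _ _ _ that])
        \<comment> \<open>Zero coefficients stay zero because \<open>\<psi>\<close> maps 0 to 0,
          while the coefficient 1 at \<open>w\<close> is lost because \<open>\<psi>\<close> maps 1
          to 0: the support strictly shrinks.\<close>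
        have "{v \<in> words (Suc m). \<psi> (\<beta>' v) \<noteq> \<zero>\<^bsub>D\<^esub>} \<subset> {v \<in> words (Suc m). \<beta> v \<noteq> \<zero>\<^bsub>D\<^esub>}"
        proof
          show "{v \<in> words (Suc m). \<psi> (\<beta>' v) \<noteq> \<zero>\<^bsub>D\<^esub>} \<subseteq> {v \<in> words (Suc m). \<beta> v \<noteq> \<zero>\<^bsub>D\<^esub>}"
            using x psi_zero by (auto simp: \<beta>'_def)
          have "w \<notin> {v \<in> words (Suc m). \<psi> (\<beta>' v) \<noteq> \<zero>\<^bsub>D\<^esub>}" by (simp add: \<beta>'w psi_one)
          then show "{v \<in> words (Suc m). \<psi> (\<beta>' v) \<noteq> \<zero>\<^bsub>D\<^esub>} \<noteq> {v \<in> words (Suc m). \<beta> v \<noteq> \<zero>\<^bsub>D\<^esub>}"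
            using nz less.prems(3) by blast
        qed
        then show "card {v \<in> words (Suc m). \<psi> (\<beta>' v) \<noteq> \<zero>\<^bsub>D\<^esub>} < card {v \<in> words (Suc m). \<beta> v \<noteq> \<zero>\<^bsub>D\<^esub>}"
          by (rule psubset_card_mono[rotated]) simp
        show "(\<lambda>v. \<psi> (\<beta>' v)) \<in> words (Suc m) \<rightarrow> carrier D" using \<beta>' by auto
        \<comment> \<open>All other terms of \<open>main\<close> lie in
          \<open>lower (Suc m)\<close>, so the layer of the \<open>\<psi> (\<beta>' v)\<close> does
          too.\<close>
        have "layer m (\<lambda>v. \<psi> (\<gamma> v)) \<oplus> t \<in> lower (Suc m)"
          by (intro lower_add lower_Suc_I[OF t] layer_in_lower) (use \<gamma> in \<open>auto simp: Pi_def\<close>)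
        moreover have "layer m A \<oplus> word_layer m B \<in> lower (Suc m)"
          by (intro lower_add lower_Suc_I[OF wB] layer_in_lower) (use A in auto)
        ultimately show "layer (Suc m) (\<lambda>v. \<psi> (\<beta>' v)) \<in> lower (Suc m)"
          using main c by (metis lower_minus_cancel)
      qed
      have "layer (Suc m) (\<lambda>v. \<psi> (\<beta>' v)) = \<zero>" by (rule layer_zero) (rule psi0)
      with main c have main': "layer m A \<oplus> word_layer m B = layer m (\<lambda>v. \<psi> (\<gamma> v)) \<oplus> t"
        by simp
      obtain i v where w: "w = i # v" "i \<in> I" "v \<in> words m"
        using less.prems(3) by (auto simp: words_Suc)
      \<comment> \<open>With the top layer gone, the layers of \<open>A\<close> and of the
        \<open>\<psi> (\<gamma> v)\<close> agree modulo \<open>lower m\<close>; the outer induction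
        hypothesis applies to their difference.\<close>
      have "layer m (\<lambda>v. A v \<oplus>\<^bsub>D\<^esub> \<ominus>\<^bsub>D\<^esub> \<psi> (\<gamma> v)) = layer m A \<oplus> \<ominus> layer m (\<lambda>v. \<psi> (\<gamma> v))"
      proof -
        have "layer m (\<lambda>v. \<ominus>\<^bsub>D\<^esub> \<psi> (\<gamma> v)) = layer m (\<lambda>v. (\<ominus>\<^bsub>D\<^esub> \<one>\<^bsub>D\<^esub>) \<otimes>\<^bsub>D\<^esub> \<psi> (\<gamma> v))"
          unfolding layer_def
          by (rule S.finsum_cong') (use \<gamma> in \<open>auto simp: Pi_def R.l_minus\<close>)
        also have "\<dots> = \<phi> (\<ominus>\<^bsub>D\<^esub> \<one>\<^bsub>D\<^esub>) \<otimes> layer m (\<lambda>v. \<psi> (\<gamma> v))"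
          by (rule layer_lmult[symmetric]) (use \<gamma> in \<open>auto simp: Pi_def\<close>)
        finally have "layer m (\<lambda>v. \<ominus>\<^bsub>D\<^esub> \<psi> (\<gamma> v)) = \<ominus> layer m (\<lambda>v. \<psi> (\<gamma> v))"
          using c by (simp add: S.l_minus)
        then show ?thesis
          by (subst layer_add[symmetric]) (use A \<gamma> in \<open>auto simp: Pi_def\<close>)
      qed
      also have "\<dots> = t \<oplus> \<ominus> word_layer m B"
      proof -
        have "layer m A = layer m (\<lambda>v. \<psi> (\<gamma> v)) \<oplus> t \<oplus> \<ominus> word_layer m B"
          using main' c by (metis S.a_closed S.a_inv_closed S.a_assoc S.r_neg S.r_zero)
        then show ?thesis using c by (simp add: S.a_ac S.r_neg S.r_neg2 S.r_neg1)
      qed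
      also have "\<dots> \<in> lower m" by (intro lower_add lower_minus t wB)
      finally have "A v \<oplus>\<^bsub>D\<^esub> \<ominus>\<^bsub>D\<^esub> \<psi> (\<gamma> v) = \<zero>\<^bsub>D\<^esub>"
        by (rule outer_IH[rotated]) (use A \<gamma> w in \<open>auto simp: Pi_def\<close>)
      then have Av: "A v = \<psi> (\<gamma> v)" using A \<gamma> w
        by (metis R.add.inv_closed R.minus_equality R.minus_minus closed(2) funcset_mem R.add.m_comm)
      \<comment> \<open>The tail \<open>v\<close> of \<open>w\<close> is fixed and all first letters
        are considered together. Since \<open>w\<close> is \<open>i # v\<close>, the outcome
        contradicts the coefficient 1 there.\<close>
      have "\<beta>' (i # v) = \<zero>\<^bsub>D\<^esub>"
        by (rule psi_sum_eq[where c = "\<lambda>i. \<beta>' (i # v)" and x = "\<gamma> v"])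
          (use w \<gamma> \<beta>' psi0 Cons_words Av in \<open>auto simp: A_def\<close>)
      then show False using \<beta>'w w D.one_not_zero by simp
    qed
  qed
qed

section \<open>Relations between words of different lengths\<close>

definition words_below :: "nat \<Rightarrow> 'i list set" where
  "words_below m = {w. set w \<subseteq> I \<and> length w < m}"

lemma words_below_Suc: "words_below (Suc m) = words m \<union> words_below m"
  by (auto simp: words_below_def words_def)

lemma finite_words_below [simp]: "finite (words_below m)"
  by (induction m) (auto simp: words_below_Suc, simp add: words_below_def)

lemma words_below_closed: "w \<in> words_below m \<Longrightarrow> word_eval w \<in> carrier Q"
  by (simp add: words_below_def word_eval_closed)

text \<open>The longest words form a layer and all others lie in \<open>lower m\<close>, so
  \<open>layer_independent\<close> removes the top layer and the induction continues with the
  rest.\<close>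

lemma words_below_independent:
  assumes "\<beta> \<in> words_below m \<rightarrow> carrier D" "w \<in> words_below m"
    and "(\<Oplus>w\<in>words_below m. \<phi> (\<beta> w) \<otimes> (Y \<otimes> word_eval w)) \<in> S"
  shows "\<beta> w = \<zero>\<^bsub>D\<^esub>"
  using assms
proof (induction m arbitrary: w)
  case 0
  then show ?case by (simp add: words_below_def)
next
  case (Suc m)
  let ?g = "\<lambda>w. \<phi> (\<beta> w) \<otimes> (Y \<otimes> word_eval w)"
  let ?s = "\<Oplus>w\<in>words_below m. ?g w"
  have \<beta>: "\<beta> \<in> words m \<rightarrow> carrier D" "\<beta> \<in> words_below m \<rightarrow> carrier D"
    using Suc.prems by (auto simp: words_below_Suc)
  have "(\<Oplus>w\<in>words_below (Suc m). ?g w) = layer m \<beta> \<oplus> ?s"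
    unfolding words_below_Suc layer_def
    by (rule S.finsum_Un_disjoint)
      (use \<beta> in \<open>auto simp: Pi_def words_below_closed\<close>, auto simp: words_below_def words_def)
  with Suc.prems have sum: "layer m \<beta> \<oplus> ?s \<in> S" by simp
  have s: "?s \<in> lower m"
  proof (rule lower_finsum)
    fix v assume v: "v \<in> words_below m"
    \<comment> \<open>A term with a word of length \<open>l\<close> belongs to
      \<open>lower (Suc l)\<close>, hence the strict bound on lengths in
      \<open>words_below\<close>.\<close>
    then have "v \<in> words (length v)" "Suc (length v) \<le> m"
      by (auto simp: words_below_def words_def)
    then show "?g v \<in> lower m"
      using term_in_lower[of v "length v" "\<beta> v"] \<beta> v lower_mono by blast
  qed simp
  have "layer m \<beta> \<in> lower m"
    by (rule lower_minus_cancel[OF _ s]) (use sum lower_mono[of 0 m] \<beta> in auto)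
  then have z: "\<beta> v = \<zero>\<^bsub>D\<^esub>" if "v \<in> words m" for v
    using layer_independent \<beta> that by blast
  then have "layer m \<beta> = \<zero>" by (simp add: layer_zero)
  with sum s have "?s \<in> S" by (simp add: lower_closed)
  then show ?case using Suc.IH[OF \<beta>(2)] z Suc.prems(2) by (auto simp: words_below_Suc)
qed

text \<open>Coefficients commuting with \<open>Y\<close> let a left multiplication by
  \<open>Y\<close> turn the relation into one between the elements \<open>Y w\<close>, with value 0
  in \<open>S\<close>.\<close>

lemma words_independent:
  assumes W: "finite W" "W \<subseteq> lists I"
    and c: "\<And>w. w \<in> W \<Longrightarrow> c w \<in> carrier D"
    and central: "\<And>w. w \<in> W \<Longrightarrow> Y \<otimes> \<phi> (c w) = \<phi> (c w) \<otimes> Y"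
    and sum: "(\<Oplus>w\<in>W. \<phi> (c w) \<otimes> word_eval w) = \<zero>"
    and w: "w \<in> W"
  shows "c w = \<zero>\<^bsub>D\<^esub>"
proof -
  obtain m where "\<forall>w\<in>W. length w \<le> m"
    using finite_imageI[OF W(1), of length] by (meson finite_nat_set_iff_bounded_le imageI)
  then have Wm: "W \<subseteq> words_below (Suc m)"
    using W(2) by (auto simp: words_below_def in_lists_conv_set)
  \<comment> \<open>Extension by zero to all words up to the greatest length in
    \<open>W\<close>.\<close>
  define \<beta> where "\<beta> v = (if v \<in> W then c v else \<zero>\<^bsub>D\<^esub>)" for v
  have ev: "word_eval v \<in> carrier Q" if "v \<in> W" for v
    using that Wm words_below_closed by blast
  have "(\<Oplus>w\<in>words_below (Suc m). \<phi> (\<beta> w) \<otimes> (Y \<otimes> word_eval w)) =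
      (\<Oplus>w\<in>W. Y \<otimes> (\<phi> (c w) \<otimes> word_eval w))"
  proof (rule S.add.finprod_mono_neutral_cong_right)
    show "\<phi> (\<beta> v) \<otimes> (Y \<otimes> word_eval v) = Y \<otimes> (\<phi> (c v) \<otimes> word_eval v)" if "v \<in> W" for v
      using that ev central c by (simp add: \<beta>_def S.m_assoc[symmetric])
  qed (use Wm c words_below_closed in \<open>auto simp: \<beta>_def\<close>)
  also have "\<dots> = Y \<otimes> (\<Oplus>w\<in>W. \<phi> (c w) \<otimes> word_eval w)"
    by (rule S.finsum_rdistr[symmetric]) (use W c ev in auto)
  also have "\<dots> = \<zero>" by (simp add: sum)
  finally have "(\<Oplus>w\<in>words_below (Suc m). \<phi> (\<beta> w) \<otimes> (Y \<otimes> word_eval w)) \<in> S"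
    using lower_zero[of 0] by simp
  then have "\<beta> w = \<zero>\<^bsub>D\<^esub>"
    by (rule words_below_independent[rotated 2]) (use w Wm c in \<open>auto simp: \<beta>_def\<close>)
  then show ?thesis using w by (simp add: \<beta>_def)
qed

end

section \<open>The skew polynomial ring\<close>

lemma skew_poly_simps [simp]:
  "carrier (skew_poly D \<sigma> \<delta>) = up D"
  "mult (skew_poly D \<sigma> \<delta>) = skew_mult D \<sigma> \<delta>"
  "one (skew_poly D \<sigma> \<delta>) = (\<lambda>i. if i = 0 then \<one>\<^bsub>D\<^esub> else \<zero>\<^bsub>D\<^esub>)"
  "zero (skew_poly D \<sigma> \<delta>) = (\<lambda>i. \<zero>\<^bsub>D\<^esub>)"
  "add (skew_poly D \<sigma> \<delta>) = (\<lambda>p\<in>up D. \<lambda>q\<in>up D. \<lambda>i. p i \<oplus>\<^bsub>D\<^esub> q i)"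
  "monom (skew_poly D \<sigma> \<delta>) = (\<lambda>a\<in>carrier D. \<lambda>n i. if i = n then a else \<zero>\<^bsub>D\<^esub>)"
  by (simp_all add: skew_poly_def UP_def)

lemma (in ring) monom_in_up: "x \<in> carrier R \<Longrightarrow> (\<lambda>i. if i = n then x else \<zero>) \<in> up R"
  by (auto simp: up_def intro!: exI[of _ n])

locale skew_polynomials = division_algebra K D
  for K :: "('k, 'a) ring_scheme" and D :: "('k, 'd, 'm) module_scheme" (structure) +
  fixes \<sigma> \<delta> :: "'d \<Rightarrow> 'd"
  assumes automorphism: "k_automorphism K D \<sigma>"
    and derivation: "sigma_derivation K D \<sigma> \<delta>"
begin

definition P where "P = skew_poly D \<sigma> \<delta>"

lemma sigma_hom: "\<sigma> \<in> ring_hom D D" and sigma_bij: "bij_betw \<sigma> (carrier D) (carrier D)"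
  and sigma_linear: "k_linear K D \<sigma>"
  using automorphism by (auto simp: k_automorphism_def ring_iso_def)

lemma delta_linear: "k_linear K D \<delta>"
  using derivation by (simp add: sigma_derivation_def)

lemma sigma_closed [simp]: "x \<in> carrier D \<Longrightarrow> \<sigma> x \<in> carrier D"
  and delta_closed [simp]: "x \<in> carrier D \<Longrightarrow> \<delta> x \<in> carrier D"
  using sigma_linear delta_linear by (auto simp: k_linear_def)

lemma sigma_one: "\<sigma> \<one> = \<one>"
  using sigma_hom by (rule ring_hom_one)

lemma k_linear_zero:
  assumes "k_linear K D h" shows "h \<zero> = \<zero>"
proof -
  have "h (\<zero> \<oplus> \<zero>) = h \<zero> \<oplus> h \<zero>" "h \<zero> \<in> carrier D"
    using assms M.zero_closed unfolding k_linear_def by blast+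
  then show ?thesis by simp
qed

lemma sigma_zero: "\<sigma> \<zero> = \<zero>" and delta_zero: "\<delta> \<zero> = \<zero>"
  by (simp_all add: k_linear_zero sigma_linear delta_linear)

lemma delta_one: "\<delta> \<one> = \<zero>"
proof -
  have "\<delta> (\<one> \<otimes> \<one>) = \<sigma> \<one> \<otimes> \<delta> \<one> \<oplus> \<delta> \<one> \<otimes> \<one>"
    using derivation D.one_closed unfolding sigma_derivation_def by blast
  then show ?thesis by (simp add: sigma_one)
qed

section \<open>Scalars inside \<open>D\<close>\<close>

definition scal :: "'k \<Rightarrow> 'd" where "scal c = c \<odot> \<one>"

lemma scal_closed [simp]: "c \<in> carrier K \<Longrightarrow> scal c \<in> carrier D"
  by (simp add: scal_def)

lemma sigma_scal: "c \<in> carrier K \<Longrightarrow> \<sigma> (scal c) = scal c"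
  using sigma_linear D.one_closed unfolding scal_def k_linear_def by (metis sigma_one)

lemma delta_scal: "c \<in> carrier K \<Longrightarrow> \<delta> (scal c) = \<zero>"
  using delta_linear D.one_closed unfolding scal_def k_linear_def by (metis delta_one smult_r_null)

lemma scal_mult_left: "c \<in> carrier K \<Longrightarrow> x \<in> carrier D \<Longrightarrow> scal c \<otimes> x = c \<odot> x"
  and scal_mult_right: "c \<in> carrier K \<Longrightarrow> x \<in> carrier D \<Longrightarrow> x \<otimes> scal c = c \<odot> x"
  by (simp_all add: scal_def smult_mult_left smult_mult_right)

lemma scal_mult: "c \<in> carrier K \<Longrightarrow> d \<in> carrier K \<Longrightarrow> scal c \<otimes> scal d = scal (c \<otimes>\<^bsub>K\<^esub> d)"
  by (simp add: scal_mult_left) (simp add: scal_def smult_assoc1)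

lemma scal_one: "scal \<one>\<^bsub>K\<^esub> = \<one>"
  by (simp add: scal_def)

lemma scal_minus: "c \<in> carrier K \<Longrightarrow> d \<in> carrier K \<Longrightarrow> scal (c \<ominus>\<^bsub>K\<^esub> d) = scal c \<ominus> scal d"
  by (simp add: scal_def a_minus_def smult_l_distr smult_l_minus)

lemma scal_eq_zero:
  assumes "c \<in> carrier K" "scal c = \<zero>" shows "c = \<zero>\<^bsub>K\<^esub>"
proof (rule ccontr)
  assume "c \<noteq> \<zero>\<^bsub>K\<^esub>"
  then have u: "c \<in> Units K" using assms K.field_Units by auto
  then have "\<one> = scal (inv\<^bsub>K\<^esub> c) \<otimes> scal c" using assms(1) by (simp add: scal_mult scal_one K.Units_l_inv K.Units_inv_closed)
  also have "\<dots> = \<zero>" using assms u by simp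
  finally show False using D.one_not_zero by simp
qed

section \<open>Products with constants, with the indeterminate and with linear polynomials\<close>

lemma skew_mult_const:
  assumes "x \<in> carrier D" "r \<in> up D"
  shows "monom P x 0 \<otimes>\<^bsub>P\<^esub> r = (\<lambda>j. x \<otimes> r j)"
proof
  fix j
  have "r j \<in> carrier D" using assms by auto
  \<comment> \<open>For \<open>x = \<zero>\<close> the support is empty, and the defining sum of the
    product is the empty sum.\<close>
  moreover have "{i. (if i = 0 then x else \<zero>) \<noteq> \<zero>} = (if x = \<zero> then {} else {0::nat})" by auto
  ultimately show "(monom P x 0 \<otimes>\<^bsub>P\<^esub> r) j = x \<otimes> r j"
    using assms by (simp add: P_def skew_mult_def)
qed

lemma left_mult_X_closed:
  assumes "r \<in> up D" shows "left_mult_X D \<sigma> \<delta> r \<in> up D"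
proof
  have r: "r i \<in> carrier D" for i using assms by auto
  then show "left_mult_X D \<sigma> \<delta> r j \<in> carrier D" for j
    by (simp add: left_mult_X_def)
  obtain n where n: "bound \<zero> n r" using assms by auto
  have "bound \<zero> (Suc n) (left_mult_X D \<sigma> \<delta> r)"
  proof
    fix j assume "Suc n < j"
    then have "r j = \<zero>" "r (j - 1) = \<zero>" using n by (auto simp: bound_def)
    then show "left_mult_X D \<sigma> \<delta> r j = \<zero>" by (simp add: left_mult_X_def sigma_zero delta_zero)
  qed
  then show "\<exists>n. bound \<zero> n (left_mult_X D \<sigma> \<delta> r)" ..
qed

lemma skew_mult_X:
  assumes "r \<in> up D"
  shows "monom P \<one> 1 \<otimes>\<^bsub>P\<^esub> r = left_mult_X D \<sigma> \<delta> r"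
proof
  fix j
  have "left_mult_X D \<sigma> \<delta> r j \<in> carrier D" using left_mult_X_closed[OF assms] by auto
  moreover have "{i. (if i = Suc 0 then \<one> else \<zero>) \<noteq> \<zero>} = {Suc 0}" using D.one_not_zero by auto
  ultimately show "(monom P \<one> 1 \<otimes>\<^bsub>P\<^esub> r) j = left_mult_X D \<sigma> \<delta> r j"
    by (simp add: P_def skew_mult_def)
qed

definition lin :: "'k \<Rightarrow> 'k \<Rightarrow> nat \<Rightarrow> 'd" where
  "lin a b j = (if j = 0 then scal a else if j = 1 then scal b else \<zero>)"

lemma linear_poly_eq: "a \<in> carrier K \<Longrightarrow> b \<in> carrier K \<Longrightarrow> linear_poly D P a b = lin a b"
  by (auto simp: linear_poly_def P_def lin_def monom_in_up scal_def fun_eq_iff)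

lemma lin_closed: "a \<in> carrier K \<Longrightarrow> b \<in> carrier K \<Longrightarrow> lin a b \<in> up D"
  by (auto simp: up_def lin_def intro!: exI[of _ 1])

text \<open>Scalars are fixed by \<open>\<sigma>\<close> and killed by \<open>\<delta>\<close>, so
  multiplication by the indeterminate merely shifts the coefficients.\<close>

lemma left_mult_X_power_lin:
  assumes "a \<in> carrier K" "b \<in> carrier K"
  shows "(left_mult_X D \<sigma> \<delta> ^^ i) (lin a b) =
    (\<lambda>j. if j = i then scal a else if j = Suc i then scal b else \<zero>)"
proof (induction i)
  case 0
  then show ?case by (simp add: lin_def fun_eq_iff)
next
  case (Suc i)
  then show ?case using assms
    by (auto simp: fun_eq_iff left_mult_X_def sigma_scal delta_scal sigma_zero delta_zero)
qed

lemma skew_mult_lin: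
  assumes a: "a \<in> carrier K" "b \<in> carrier K" and r: "r \<in> up D"
  shows "(r \<otimes>\<^bsub>P\<^esub> lin a b) j =
    r j \<otimes> scal a \<oplus> (if j = 0 then \<zero> else r (j - 1) \<otimes> scal b)"
proof -
  have rc: "r i \<in> carrier D" for i using r by auto
  obtain n where n: "bound \<zero> n r" using r by auto
  have "{i. r i \<noteq> \<zero>} \<subseteq> {..n}" using bound_below[OF n] by auto
  then have fin: "finite {i. r i \<noteq> \<zero>}" by (rule finite_subset) simp
  let ?g = "\<lambda>i. r i \<otimes> (if j = i then scal a else if j = Suc i then scal b else \<zero>)"
  have "(r \<otimes>\<^bsub>P\<^esub> lin a b) j = (\<Oplus>i\<in>{i. r i \<noteq> \<zero>}. ?g i)"
    by (simp add: P_def skew_mult_def left_mult_X_power_lin a)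
  \<comment> \<open>Only the indices \<open>j - 1\<close> and \<open>j\<close> can contribute. They
    coincide for \<open>j = 0\<close> because subtraction is truncated, so that case is separate
    below.\<close>
  also have "\<dots> = (\<Oplus>i\<in>{j - 1, j}. ?g i)"
    by (rule M.add.finprod_mono_neutral_cong) (use fin rc a in auto)
  also have "\<dots> = r j \<otimes> scal a \<oplus> (if j = 0 then \<zero> else r (j - 1) \<otimes> scal b)"
  proof (cases j)
    case (Suc i)
    then show ?thesis using rc a M.a_comm by simp
  qed (use rc a in simp)
  finally show ?thesis .
qed

lemma skew_mult_lin_closed:
  assumes a: "a \<in> carrier K" "b \<in> carrier K" and r: "r \<in> up D"
  shows "r \<otimes>\<^bsub>P\<^esub> lin a b \<in> up D"
proof
  have rc: "r i \<in> carrier D" for i using r by auto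
  then show "(r \<otimes>\<^bsub>P\<^esub> lin a b) j \<in> carrier D" for j
    using a by (simp add: skew_mult_lin[OF a r])
  obtain n where "bound \<zero> n r" using r by auto
  then have "bound \<zero> (Suc n) (r \<otimes>\<^bsub>P\<^esub> lin a b)"
    using a by (auto simp: bound_def skew_mult_lin[OF a r])
  then show "\<exists>n. bound \<zero> n (r \<otimes>\<^bsub>P\<^esub> lin a b)" ..
qed

text \<open>A degree argument: the positive coefficients of the product vanish and
  \<open>scal b\<close> is invertible, so a zero coefficient of \<open>r\<close> forces the
  preceding one to be zero. Starting beyond the degree this gives \<open>r 0 = \<zero>\<close>, and
  \<open>x\<close> is \<open>r 0\<close> times \<open>scal a\<close>.\<close>

lemma skew_mult_lin_eq_const:
  assumes a: "a \<in> carrier K" "b \<in> carrier K" "b \<noteq> \<zero>\<^bsub>K\<^esub>"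
    and r: "r \<in> up D" and x: "x \<in> carrier D"
    and eq: "r \<otimes>\<^bsub>P\<^esub> lin a b = monom P x 0"
  shows "x = \<zero>"
proof -
  have rc: "r i \<in> carrier D" for i using r by auto
  have b: "scal b \<in> Units D" using a scal_eq_zero by (auto simp: D.Units_eq)
  have step: "r i = \<zero>" if "r (Suc i) = \<zero>" for i
  proof -
    have "(r \<otimes>\<^bsub>P\<^esub> lin a b) (Suc i) = \<zero>"
      using x by (simp add: eq) (simp add: P_def)
    then have "r i \<otimes> scal b = \<zero>" using that a rc by (simp add: skew_mult_lin[OF a(1,2) r])
    then have "r i \<otimes> scal b \<otimes> inv scal b = \<zero>" using b by simp
    then show ?thesis using b rc a by (simp add: D.m_assoc)
  qed
  obtain n where n: "bound \<zero> n r" using r by auto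
  \<comment> \<open>Downward induction from \<open>Suc n\<close>, the first index beyond the bound
    \<open>n\<close>.\<close>
  have "r 0 = \<zero>"
    by (rule inc_induct[of 0 "Suc n"]) (use n step in \<open>auto simp: bound_def\<close>)
  then have "(r \<otimes>\<^bsub>P\<^esub> lin a b) 0 = \<zero>" using a by (simp add: skew_mult_lin[OF a(1,2) r])
  then show ?thesis using x by (simp add: eq) (simp add: P_def)
qed

end

section \<open>The division ring of fractions\<close>

locale skew_fractions = skew_polynomials K D \<sigma> \<delta>
  for K :: "('k, 'a) ring_scheme" and D :: "('k, 'd, 'm) module_scheme" (structure) and \<sigma> \<delta> +
  fixes Q :: "('q, 'n) ring_scheme" and \<iota> :: "(nat \<Rightarrow> 'd) \<Rightarrow> 'q"
  assumes fractions: "division_ring_of_fractions (skew_poly D \<sigma> \<delta>) Q \<iota>"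
begin

sublocale Q: skew_field Q
  using fractions by (simp add: division_ring_of_fractions_def)

lemma iota_hom: "\<iota> \<in> ring_hom P Q" and iota_inj: "inj_on \<iota> (up D)"
  using fractions by (simp_all add: division_ring_of_fractions_def P_def)

lemma iota_closed [simp]: "r \<in> up D \<Longrightarrow> \<iota> r \<in> carrier Q"
  and iota_mult: "r \<in> up D \<Longrightarrow> s \<in> up D \<Longrightarrow> \<iota> (r \<otimes>\<^bsub>P\<^esub> s) = \<iota> r \<otimes>\<^bsub>Q\<^esub> \<iota> s"
  and iota_add: "r \<in> up D \<Longrightarrow> s \<in> up D \<Longrightarrow> \<iota> (r \<oplus>\<^bsub>P\<^esub> s) = \<iota> r \<oplus>\<^bsub>Q\<^esub> \<iota> s"
  and iota_one: "\<iota> \<one>\<^bsub>P\<^esub> = \<one>\<^bsub>Q\<^esub>"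
  using iota_hom by (simp_all add: P_def ring_hom_def Pi_def)

abbreviation \<phi> where "\<phi> \<equiv> coeff_embed P \<iota>"

lemma monom_closed [simp]: "x \<in> carrier D \<Longrightarrow> monom P x n \<in> up D"
  by (simp add: P_def monom_in_up)

lemma phi_mult_iota: "x \<in> carrier D \<Longrightarrow> r \<in> up D \<Longrightarrow> \<phi> x \<otimes>\<^bsub>Q\<^esub> \<iota> r = \<iota> (\<lambda>j. x \<otimes> r j)"
  using iota_mult[of "monom P x 0" r] by (simp add: coeff_embed_def skew_mult_const)

lemma phi_hom: "\<phi> \<in> ring_hom D Q"
proof (rule ring_hom_memI)
  fix x y assume xy: "x \<in> carrier D" "y \<in> carrier D"
  have "(\<lambda>j. x \<otimes> monom P y 0 j) = monom P (x \<otimes> y) 0"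
    using xy by (simp add: P_def fun_eq_iff)
  then show "\<phi> (x \<otimes> y) = \<phi> x \<otimes>\<^bsub>Q\<^esub> \<phi> y"
    using phi_mult_iota[of x "monom P y 0"] xy by (simp add: coeff_embed_def)
  have "monom P (x \<oplus> y) 0 = monom P x 0 \<oplus>\<^bsub>P\<^esub> monom P y 0"
    using xy by (simp add: P_def fun_eq_iff monom_in_up)
  then show "\<phi> (x \<oplus> y) = \<phi> x \<oplus>\<^bsub>Q\<^esub> \<phi> y"
    using xy by (simp add: coeff_embed_def iota_add)
next
  have "monom P \<one> 0 = \<one>\<^bsub>P\<^esub>" by (simp add: P_def fun_eq_iff)
  then show "\<phi> \<one> = \<one>\<^bsub>Q\<^esub>" by (simp add: coeff_embed_def iota_one)
qed (simp add: coeff_embed_def)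

sublocale phi: ring_hom_ring D Q \<phi>
  by (rule ring_hom_ringI2[OF D.ring_axioms Q.ring_axioms phi_hom])

section \<open>The set of polynomials in \<open>Q\<close> and the indeterminate\<close>

lemma polynomial_add:
  assumes "s \<in> \<iota> ` up D" "t \<in> \<iota> ` up D" shows "s \<oplus>\<^bsub>Q\<^esub> t \<in> \<iota> ` up D"
proof -
  obtain u v where uv: "u \<in> up D" "v \<in> up D" "s = \<iota> u" "t = \<iota> v" using assms by blast
  then have "s \<oplus>\<^bsub>Q\<^esub> t = \<iota> (\<lambda>i. u i \<oplus> v i)" using iota_add[of u v] by (simp add: P_def)
  then show ?thesis using uv D.up_add_closed by blast
qed

lemma phi_mult_polynomial:
  "x \<in> carrier D \<Longrightarrow> s \<in> \<iota> ` up D \<Longrightarrow> \<phi> x \<otimes>\<^bsub>Q\<^esub> s \<in> \<iota> ` up D"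
  by (auto simp: phi_mult_iota intro!: D.up_smult_closed)

definition X where "X = \<iota> (monom P \<one> 1)"

lemma X_closed [simp]: "X \<in> carrier Q"
  by (simp add: X_def)

lemma X_mult_iota: "r \<in> up D \<Longrightarrow> X \<otimes>\<^bsub>Q\<^esub> \<iota> r = \<iota> (left_mult_X D \<sigma> \<delta> r)"
  using iota_mult[of "monom P \<one> 1" r] by (simp add: X_def skew_mult_X[unfolded One_nat_def])

lemma iota_monom_1:
  assumes "x \<in> carrier D" shows "\<iota> (monom P x 1) = \<phi> x \<otimes>\<^bsub>Q\<^esub> X"
proof -
  have "(\<lambda>j. x \<otimes> monom P \<one> 1 j) = monom P x 1"
    using assms by (simp add: P_def fun_eq_iff)
  then show ?thesis using phi_mult_iota[of x "monom P \<one> 1"] assms by (simp add: X_def)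
qed

lemma X_commute:
  assumes "x \<in> carrier D"
  shows "X \<otimes>\<^bsub>Q\<^esub> \<phi> x = \<phi> (\<sigma> x) \<otimes>\<^bsub>Q\<^esub> X \<oplus>\<^bsub>Q\<^esub> \<phi> (\<delta> x)"
proof -
  have "monom P \<one> 1 \<otimes>\<^bsub>P\<^esub> monom P x 0 = monom P (\<sigma> x) 1 \<oplus>\<^bsub>P\<^esub> monom P (\<delta> x) 0"
    unfolding P_def
    using skew_poly_commutation[OF division_algebra_axioms automorphism derivation assms] .
  then have "\<iota> (monom P \<one> 1) \<otimes>\<^bsub>Q\<^esub> \<iota> (monom P x 0) = \<iota> (monom P (\<sigma> x) 1) \<oplus>\<^bsub>Q\<^esub> \<iota> (monom P (\<delta> x) 0)"
    using iota_mult[of "monom P \<one> 1" "monom P x 0"] iota_add[of "monom P (\<sigma> x) 1" "monom P (\<delta> x) 0"]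
      assms by simp
  then show ?thesis
    using assms by (simp only: X_def[symmetric] coeff_embed_def[symmetric] iota_monom_1 sigma_closed)
qed

lemma iota_lin:
  assumes "a \<in> carrier K" "b \<in> carrier K"
  shows "\<iota> (lin a b) = \<phi> (scal a) \<oplus>\<^bsub>Q\<^esub> \<phi> (scal b) \<otimes>\<^bsub>Q\<^esub> X"
proof -
  have "\<iota> (lin a b) = \<iota> (monom P (scal a) 0) \<oplus>\<^bsub>Q\<^esub> \<iota> (monom P (scal b) 1)"
    using assms
    by (simp add: linear_poly_eq[symmetric] linear_poly_def iota_add scal_def[symmetric])
  then show ?thesis using assms by (simp add: iota_monom_1[unfolded One_nat_def] coeff_embed_def)
qed

end

section \<open>Fractions with a linear denominator\<close>

locale linear_fraction = skew_fractions K D \<sigma> \<delta> Q \<iota>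
  for K :: "('k, 'a) ring_scheme" and D :: "('k, 'd, 'm) module_scheme" (structure)
    and \<sigma> \<delta> and Q :: "('q, 'n) ring_scheme" and \<iota> +
  fixes a\<^sub>0 a\<^sub>1 :: 'k
  assumes a: "a\<^sub>0 \<in> carrier K" "a\<^sub>1 \<in> carrier K" "a\<^sub>1 \<noteq> \<zero>\<^bsub>K\<^esub>"
begin

definition f where "f = \<iota> (lin a\<^sub>0 a\<^sub>1)"
definition Y where "Y = inv\<^bsub>Q\<^esub> f"
definition \<psi> where "\<psi> x = a\<^sub>1 \<odot> \<delta> x \<oplus> a\<^sub>0 \<odot> (x \<ominus> \<sigma> x)"

lemma psi_closed [simp]: "x \<in> carrier D \<Longrightarrow> \<psi> x \<in> carrier D"
  using a by (simp add: \<psi>_def)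

lemma psi_one: "\<psi> \<one> = \<zero>" and psi_zero: "\<psi> \<zero> = \<zero>"
  using a by (simp_all add: \<psi>_def sigma_one sigma_zero delta_one delta_zero a_minus_def M.r_neg)

lemma psi_smult:
  assumes "c \<in> carrier K" "x \<in> carrier D" shows "\<psi> (c \<odot> x) = c \<odot> \<psi> x"
proof -
  have l: "\<sigma> (c \<odot> x) = c \<odot> \<sigma> x" "\<delta> (c \<odot> x) = c \<odot> \<delta> x"
    using sigma_linear delta_linear assms by (auto simp: k_linear_def)
  have c: "a \<odot> (c \<odot> y) = c \<odot> (a \<odot> y)" if "y \<in> carrier D" "a \<in> carrier K" for a y
    using assms that by (simp add: smult_assoc1[symmetric] K.m_comm)
  have "c \<odot> x \<ominus> c \<odot> \<sigma> x = c \<odot> (x \<ominus> \<sigma> x)"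
    using assms by (simp add: a_minus_def smult_r_distr smult_r_minus)
  then show ?thesis using assms a by (simp add: \<psi>_def l c smult_r_distr)
qed

lemma f_closed [simp]: "f \<in> carrier Q"
  using a by (simp add: f_def lin_closed)

text \<open>The commutation rule for \<open>X\<close> contributes \<open>\<delta>\<close>. Splitting
  \<open>x\<close> as \<open>\<sigma> x\<close> plus \<open>x \<ominus> \<sigma> x\<close> in the
  constant term completes \<open>\<sigma> x\<close> times \<open>f\<close>; what remains is exactly
  \<open>\<psi> x\<close>.\<close>

lemma f_commute:
  assumes x: "x \<in> carrier D"
  shows "f \<otimes>\<^bsub>Q\<^esub> \<phi> x = \<phi> (\<sigma> x) \<otimes>\<^bsub>Q\<^esub> f \<oplus>\<^bsub>Q\<^esub> \<phi> (\<psi> x)"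
proof -
  have s: "scal a\<^sub>0 \<in> carrier D" "scal a\<^sub>1 \<in> carrier D" using a by auto
  have c: "scal a\<^sub>0 \<otimes> \<sigma> x = \<sigma> x \<otimes> scal a\<^sub>0" "scal a\<^sub>1 \<otimes> \<sigma> x = \<sigma> x \<otimes> scal a\<^sub>1"
    using a x by (simp_all add: scal_mult_left scal_mult_right)
  have "f \<otimes>\<^bsub>Q\<^esub> \<phi> x = \<phi> (scal a\<^sub>0 \<otimes> x) \<oplus>\<^bsub>Q\<^esub>
      (\<phi> (scal a\<^sub>1 \<otimes> \<sigma> x) \<otimes>\<^bsub>Q\<^esub> X \<oplus>\<^bsub>Q\<^esub> \<phi> (scal a\<^sub>1 \<otimes> \<delta> x))"
    using a x s by (simp add: f_def iota_lin Q.l_distr Q.m_assoc X_commute Q.r_distr)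
  moreover have "\<phi> (\<sigma> x) \<otimes>\<^bsub>Q\<^esub> f = \<phi> (scal a\<^sub>0 \<otimes> \<sigma> x) \<oplus>\<^bsub>Q\<^esub> \<phi> (scal a\<^sub>1 \<otimes> \<sigma> x) \<otimes>\<^bsub>Q\<^esub> X"
    unfolding c using a x s by (simp add: f_def iota_lin Q.r_distr Q.m_assoc)
  moreover have "\<psi> x = scal a\<^sub>1 \<otimes> \<delta> x \<oplus> (scal a\<^sub>0 \<otimes> x \<ominus> scal a\<^sub>0 \<otimes> \<sigma> x)"
    using a x by (simp add: \<psi>_def scal_mult_left a_minus_def smult_r_distr smult_r_minus)
  then have "\<phi> (\<psi> x) = \<phi> (scal a\<^sub>1 \<otimes> \<delta> x) \<oplus>\<^bsub>Q\<^esub> (\<phi> (scal a\<^sub>0 \<otimes> x) \<ominus>\<^bsub>Q\<^esub> \<phi> (scal a\<^sub>0 \<otimes> \<sigma> x))"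
    using x s by (simp add: a_minus_def del: phi.hom_mult)
  \<comment> \<open>Here \<open>t\<close> stands for the image of
    \<open>scal a\<^sub>0 \<otimes> \<sigma> x\<close>, which is added in the product with
    \<open>f\<close> and subtracted in \<open>\<psi> x\<close>.\<close>
  moreover have "u \<oplus>\<^bsub>Q\<^esub> (v \<oplus>\<^bsub>Q\<^esub> w) = (t \<oplus>\<^bsub>Q\<^esub> v) \<oplus>\<^bsub>Q\<^esub> (w \<oplus>\<^bsub>Q\<^esub> (u \<ominus>\<^bsub>Q\<^esub> t))"
    if "u \<in> carrier Q" "v \<in> carrier Q" "w \<in> carrier Q" "t \<in> carrier Q" for u v w t
  proof -
    have "(t \<oplus>\<^bsub>Q\<^esub> v) \<oplus>\<^bsub>Q\<^esub> (w \<oplus>\<^bsub>Q\<^esub> (u \<ominus>\<^bsub>Q\<^esub> t)) = (u \<oplus>\<^bsub>Q\<^esub> (v \<oplus>\<^bsub>Q\<^esub> w)) \<oplus>\<^bsub>Q\<^esub> (t \<oplus>\<^bsub>Q\<^esub> \<ominus>\<^bsub>Q\<^esub> t)"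
      using that by (simp add: a_minus_def Q.a_ac)
    then show ?thesis using that by (simp add: Q.r_neg)
  qed
  ultimately show ?thesis using x s by (simp del: phi.hom_mult)
qed

lemma f_mult_polynomial:
  assumes "s \<in> \<iota> ` up D" shows "f \<otimes>\<^bsub>Q\<^esub> s \<in> \<iota> ` up D"
proof -
  have s: "s \<in> carrier Q" using assms by auto
  have "X \<otimes>\<^bsub>Q\<^esub> s \<in> \<iota> ` up D" using assms by (auto simp: X_mult_iota intro: left_mult_X_closed)
  moreover have "f \<otimes>\<^bsub>Q\<^esub> s = \<phi> (scal a\<^sub>0) \<otimes>\<^bsub>Q\<^esub> s \<oplus>\<^bsub>Q\<^esub> \<phi> (scal a\<^sub>1) \<otimes>\<^bsub>Q\<^esub> (X \<otimes>\<^bsub>Q\<^esub> s)"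
    using a s by (simp add: f_def iota_lin Q.l_distr Q.m_assoc)
  ultimately show ?thesis using assms a by (simp add: polynomial_add phi_mult_polynomial)
qed

lemma f_unit: "f \<in> Units Q"
proof -
  have "f \<noteq> \<zero>\<^bsub>Q\<^esub>"
  proof
    assume f0: "f = \<zero>\<^bsub>Q\<^esub>"
    \<comment> \<open>Membership of \<open>\<iota>\<close> in \<open>ring_hom\<close> does not
      mention zero, so the zero polynomial is written as a product with the constant zero and
      handled through \<open>\<phi>\<close>. The coefficient at 1 then contradicts
      \<open>a\<^sub>1 \<noteq> \<zero>\<close>.\<close>
    have "\<iota> (\<lambda>j. \<zero> \<otimes> lin a\<^sub>0 a\<^sub>1 j) = \<phi> \<zero> \<otimes>\<^bsub>Q\<^esub> f"
      using a by (simp add: f_def phi_mult_iota[symmetric] lin_closed)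
    then have "\<iota> (\<lambda>j. \<zero> \<otimes> lin a\<^sub>0 a\<^sub>1 j) = \<iota> (lin a\<^sub>0 a\<^sub>1)"
      using f0 by (simp add: f_def)
    then have "(\<lambda>j. \<zero> \<otimes> lin a\<^sub>0 a\<^sub>1 j) = lin a\<^sub>0 a\<^sub>1"
      by (rule inj_onD[OF iota_inj]) (use a lin_closed D.up_smult_closed in auto)
    then have "\<zero> \<otimes> lin a\<^sub>0 a\<^sub>1 1 = lin a\<^sub>0 a\<^sub>1 1" by (rule fun_cong)
    then have "scal a\<^sub>1 = \<zero>" using a by (simp add: lin_def)
    then show False using a scal_eq_zero by blast
  qed
  then show ?thesis by (simp add: Q.Units_eq)
qed

lemma Y_closed [simp]: "Y \<in> carrier Q" and f_Y: "f \<otimes>\<^bsub>Q\<^esub> Y = \<one>\<^bsub>Q\<^esub>" and Y_f: "Y \<otimes>\<^bsub>Q\<^esub> f = \<one>\<^bsub>Q\<^esub>"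
  using f_unit by (simp_all add: Y_def)

lemma scal_f_commute:
  assumes "c \<in> carrier K" shows "f \<otimes>\<^bsub>Q\<^esub> \<phi> (scal c) = \<phi> (scal c) \<otimes>\<^bsub>Q\<^esub> f"
proof -
  have "\<psi> (scal c) = \<zero>" unfolding scal_def using assms a by (simp add: psi_smult psi_one)
  then show ?thesis using f_commute[of "scal c"] assms by (simp add: sigma_scal)
qed

text \<open>Scalars commute with \<open>f\<close>, hence with its inverse. This is the hypothesis
  \<open>central\<close> of \<open>words_independent\<close>.\<close>

lemma scal_Y_commute:
  assumes "c \<in> carrier K" shows "Y \<otimes>\<^bsub>Q\<^esub> \<phi> (scal c) = \<phi> (scal c) \<otimes>\<^bsub>Q\<^esub> Y"
proof -
  have "Y \<otimes>\<^bsub>Q\<^esub> \<phi> (scal c) = Y \<otimes>\<^bsub>Q\<^esub> (\<phi> (scal c) \<otimes>\<^bsub>Q\<^esub> f) \<otimes>\<^bsub>Q\<^esub> Y"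
    using assms by (simp add: Q.m_assoc f_Y)
  also have "\<dots> = Y \<otimes>\<^bsub>Q\<^esub> f \<otimes>\<^bsub>Q\<^esub> \<phi> (scal c) \<otimes>\<^bsub>Q\<^esub> Y"
    using assms by (simp add: scal_f_commute[symmetric] Q.m_assoc)
  finally show ?thesis using assms by (simp add: Y_f)
qed

text \<open>Multiplying by \<open>f\<close> on the right makes the constant \<open>x\<close> a left
  multiple of a polynomial of degree one, which is impossible unless \<open>x\<close> is
  zero.\<close>

lemma Y_notin:
  assumes x: "x \<in> carrier D" and r: "r \<in> up D" and eq: "\<phi> x \<otimes>\<^bsub>Q\<^esub> Y = \<iota> r"
  shows "x = \<zero>"
proof -
  have up: "lin a\<^sub>0 a\<^sub>1 \<in> up D" using a by (simp add: lin_closed)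
  have "\<iota> (monom P x 0) = \<phi> x \<otimes>\<^bsub>Q\<^esub> Y \<otimes>\<^bsub>Q\<^esub> f"
    using x by (simp add: Q.m_assoc Y_f) (simp add: coeff_embed_def)
  also have "\<dots> = \<iota> (r \<otimes>\<^bsub>P\<^esub> lin a\<^sub>0 a\<^sub>1)"
    by (simp add: eq iota_mult[OF r up] f_def)
  finally have "r \<otimes>\<^bsub>P\<^esub> lin a\<^sub>0 a\<^sub>1 = monom P x 0"
    using iota_inj skew_mult_lin_closed[OF a(1,2) r] x by (metis inj_onD monom_closed)
  then show ?thesis using skew_mult_lin_eq_const a r x by blast
qed

text \<open>Division with remainder of the numerator by \<open>f\<close>, with quotient
  \<open>p\<close> and constant remainder, followed by right multiplication by
  \<open>Y\<close>.\<close>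

lemma fraction_eq:
  assumes b: "b\<^sub>0 \<in> carrier K" "b\<^sub>1 \<in> carrier K"
  defines "p \<equiv> b\<^sub>1 \<otimes>\<^bsub>K\<^esub> inv\<^bsub>K\<^esub> a\<^sub>1"
  shows "\<iota> (lin b\<^sub>0 b\<^sub>1) \<otimes>\<^bsub>Q\<^esub> Y = \<phi> (scal p) \<oplus>\<^bsub>Q\<^esub> \<phi> (scal (b\<^sub>0 \<ominus>\<^bsub>K\<^esub> p \<otimes>\<^bsub>K\<^esub> a\<^sub>0)) \<otimes>\<^bsub>Q\<^esub> Y"
proof -
  have u: "a\<^sub>1 \<in> Units K" using a K.field_Units by auto
  have p: "p \<in> carrier K" using b u by (simp add: p_def K.Units_inv_closed)
  have pa1: "p \<otimes>\<^bsub>K\<^esub> a\<^sub>1 = b\<^sub>1"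
    using b a u by (simp add: p_def K.m_assoc K.Units_l_inv K.Units_inv_closed)
  have "(p \<otimes>\<^bsub>K\<^esub> a\<^sub>0) \<oplus>\<^bsub>K\<^esub> (b\<^sub>0 \<ominus>\<^bsub>K\<^esub> p \<otimes>\<^bsub>K\<^esub> a\<^sub>0) = b\<^sub>0"
    using b a p by (simp add: a_minus_def K.a_lcomm K.r_neg)
  then have "scal (p \<otimes>\<^bsub>K\<^esub> a\<^sub>0) \<oplus> scal (b\<^sub>0 \<ominus>\<^bsub>K\<^esub> p \<otimes>\<^bsub>K\<^esub> a\<^sub>0) = scal b\<^sub>0"
    using b a p by (simp add: scal_def smult_l_distr[symmetric])
  then have b0: "\<phi> (scal (p \<otimes>\<^bsub>K\<^esub> a\<^sub>0)) \<oplus>\<^bsub>Q\<^esub> \<phi> (scal (b\<^sub>0 \<ominus>\<^bsub>K\<^esub> p \<otimes>\<^bsub>K\<^esub> a\<^sub>0)) = \<phi> (scal b\<^sub>0)"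
    using b a p by (metis phi.hom_add scal_closed K.m_closed K.minus_closed)
  have "\<phi> (scal p) \<otimes>\<^bsub>Q\<^esub> f = \<phi> (scal (p \<otimes>\<^bsub>K\<^esub> a\<^sub>0)) \<oplus>\<^bsub>Q\<^esub> \<phi> (scal b\<^sub>1) \<otimes>\<^bsub>Q\<^esub> X"
    using a p by (simp add: f_def iota_lin Q.r_distr Q.m_assoc[symmetric] pa1[symmetric] scal_mult[symmetric])
  then have "\<iota> (lin b\<^sub>0 b\<^sub>1) = \<phi> (scal p) \<otimes>\<^bsub>Q\<^esub> f \<oplus>\<^bsub>Q\<^esub> \<phi> (scal (b\<^sub>0 \<ominus>\<^bsub>K\<^esub> p \<otimes>\<^bsub>K\<^esub> a\<^sub>0))"
    using b a p by (simp add: iota_lin b0[symmetric] Q.a_ac)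
  then show ?thesis using b a p by (simp add: Q.l_distr Q.m_assoc f_Y)
qed

text \<open>This supplies \<open>psi_sum_eq\<close>. The scalar \<open>q\<close> is central and
  \<open>\<psi>\<close> is compatible with scalars, so dividing by \<open>q\<close> puts the sum of
  the \<open>\<sigma> (c i) \<otimes> \<alpha> i\<close> into both the image of
  \<open>\<psi>\<close> and the span. It is therefore zero, and independence together with
  injectivity of \<open>\<sigma>\<close> finishes.\<close>

lemma scaled_sum_eq_psi:
  assumes \<alpha>: "\<alpha> \<in> I \<rightarrow> carrier D" and fin: "finite I"
    and indep: "left_lin_indep D (\<sigma> ` a_kernel D D \<psi>) I \<alpha>"
    and span: "\<psi> ` carrier D \<inter> left_span D (\<sigma> ` a_kernel D D \<psi>) I \<alpha> = {\<zero>}"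
    and q: "q \<in> carrier K" "q \<noteq> \<zero>\<^bsub>K\<^esub>"
    and c: "c \<in> I \<rightarrow> carrier D" "\<And>i. i \<in> I \<Longrightarrow> \<psi> (c i) = \<zero>" and x: "x \<in> carrier D"
    and eq: "(\<Oplus>i\<in>I. \<sigma> (c i) \<otimes> (\<alpha> i \<otimes> scal q)) = \<psi> x" and i: "i \<in> I"
  shows "c i = \<zero>"
proof -
  have u: "q \<in> Units K" using q K.field_Units by auto
  define s where "s = (\<Oplus>i\<in>I. \<sigma> (c i) \<otimes> \<alpha> i)"
  have s: "s \<in> carrier D" unfolding s_def using c \<alpha> by (auto simp: Pi_def)
  have "\<psi> x = (\<Oplus>i\<in>I. \<sigma> (c i) \<otimes> \<alpha> i \<otimes> scal q)"
    unfolding eq[symmetric] by (rule M.finsum_cong') (use c \<alpha> q in \<open>auto simp: Pi_def D.m_assoc\<close>)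
  also have "\<dots> = s \<otimes> scal q"
    unfolding s_def by (rule D.finsum_ldistr[symmetric]) (use c \<alpha> q fin in \<open>auto simp: Pi_def\<close>)
  finally have "\<psi> (inv\<^bsub>K\<^esub> q \<odot> x) = inv\<^bsub>K\<^esub> q \<odot> (q \<odot> s)"
    using x s q u by (simp add: psi_smult scal_mult_right K.Units_inv_closed)
  also have "\<dots> = s" using s q u by (simp add: smult_assoc1[symmetric] K.Units_l_inv K.Units_inv_closed)
  finally have "s \<in> \<psi> ` carrier D" using x u by (metis imageI smult_closed K.Units_inv_closed)
  moreover have E: "(\<lambda>i. \<sigma> (c i)) \<in> I \<rightarrow> \<sigma> ` a_kernel D D \<psi>"
    using c by (auto simp: a_kernel_def')
  then have "s \<in> left_span D (\<sigma> ` a_kernel D D \<psi>) I \<alpha>"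
    unfolding left_span_def s_def by (auto intro!: exI[of _ "\<lambda>i. \<sigma> (c i)"])
  ultimately have "s = \<zero>" using span by blast
  then have "\<sigma> (c i) = \<zero>"
    using bspec[OF indep[unfolded left_lin_indep_def] E] i by (simp add: s_def)
  moreover have "inj_on \<sigma> (carrier D)" using sigma_bij by (simp add: bij_betw_def)
  moreover have "c i \<in> carrier D" using c i by auto
  ultimately show ?thesis using sigma_zero by (metis inj_onD M.zero_closed)
qed

lemma fraction_freely_generates:
  assumes b: "b\<^sub>0 \<in> carrier K" "b\<^sub>1 \<in> carrier K"
  defines "\<Xi> \<equiv> \<iota> (lin b\<^sub>0 b\<^sub>1) \<otimes>\<^bsub>Q\<^esub> Y"
  assumes not_scalar: "\<Xi> \<notin> scalar_embed D P \<iota> ` carrier K"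
    and fin: "finite I" and \<alpha>: "\<alpha> \<in> I \<rightarrow> carrier D"
    and indep: "left_lin_indep D (\<sigma> ` a_kernel D D \<psi>) I \<alpha>"
    and span: "\<psi> ` carrier D \<inter> left_span D (\<sigma> ` a_kernel D D \<psi>) I \<alpha> = {\<zero>}"
  shows "freely_generates K Q (scalar_embed D P \<iota>) I (\<lambda>i. \<phi> (\<alpha> i) \<otimes>\<^bsub>Q\<^esub> \<Xi>)"
proof -
  define p where "p = b\<^sub>1 \<otimes>\<^bsub>K\<^esub> inv\<^bsub>K\<^esub> a\<^sub>1"
  define q where "q = b\<^sub>0 \<ominus>\<^bsub>K\<^esub> p \<otimes>\<^bsub>K\<^esub> a\<^sub>0"
  have p: "p \<in> carrier K" using b a K.field_Units by (auto simp: p_def)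
  have q: "q \<in> carrier K" using b a p by (simp add: q_def)
  have \<Xi>: "\<Xi> = \<phi> (scal p) \<oplus>\<^bsub>Q\<^esub> \<phi> (scal q) \<otimes>\<^bsub>Q\<^esub> Y"
    unfolding \<Xi>_def q_def p_def by (rule fraction_eq[OF b])
  have \<Xi>_closed: "\<Xi> \<in> carrier Q" unfolding \<Xi> using p q by simp
  have embed: "scalar_embed D P \<iota> c = \<phi> (scal c)" for c by (simp add: scalar_embed_def scal_def)
  \<comment> \<open>With zero remainder \<open>\<Xi>\<close> would equal the scalar
    \<open>p\<close>.\<close>
  have q0: "q \<noteq> \<zero>\<^bsub>K\<^esub>"
  proof
    assume "q = \<zero>\<^bsub>K\<^esub>"
    then have "scal q = \<zero>" by (simp add: scal_def)
    then have "\<Xi> = scalar_embed D P \<iota> p" using p by (simp add: \<Xi> embed)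
    then show False using not_scalar p by blast
  qed
  \<comment> \<open>The role of \<open>S\<close> is played by the polynomials: \<open>f\<close> maps
    them to themselves, and by \<open>Y_notin\<close> no nonzero \<open>D\<close>-multiple of
    \<open>Y\<close> is one.\<close>
  interpret W: skew_inverse D Q \<phi> \<sigma> \<psi> f Y "\<iota> ` up D" I \<alpha> "scal p" "scal q"
  proof
    show "\<one>\<^bsub>Q\<^esub> \<in> \<iota> ` up D"
      using iota_one D.up_one_closed by (auto simp: P_def intro!: rev_image_eqI)
    show "f \<otimes>\<^bsub>Q\<^esub> s \<in> \<iota> ` up D" if "s \<in> \<iota> ` up D" for s
      using that by (rule f_mult_polynomial)
    show "s \<oplus>\<^bsub>Q\<^esub> t \<in> \<iota> ` up D" if "s \<in> \<iota> ` up D" "t \<in> \<iota> ` up D" for s t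
      using that by (rule polynomial_add)
    show "\<phi> x \<otimes>\<^bsub>Q\<^esub> s \<in> \<iota> ` up D" if "x \<in> carrier D" "s \<in> \<iota> ` up D" for x s
      using that by (rule phi_mult_polynomial)
    show "c i = \<zero>" if "c \<in> I \<rightarrow> carrier D" "\<And>i. i \<in> I \<Longrightarrow> \<psi> (c i) = \<zero>" "x \<in> carrier D"
      "(\<Oplus>i\<in>I. \<sigma> (c i) \<otimes> (\<alpha> i \<otimes> scal q)) = \<psi> x" "i \<in> I" for c x i
      by (rule scaled_sum_eq_psi[OF \<alpha> fin indep span q q0 that])
    show "x = \<zero>" if "x \<in> carrier D" "\<phi> x \<otimes>\<^bsub>Q\<^esub> Y \<in> \<iota> ` up D" for x
      using that Y_notin by blast
  qed (use fin \<alpha> p q in \<open>auto simp: sigma_one sigma_zero psi_one psi_zero f_Y f_commute\<close>)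
  have letter: "W.letter i = \<phi> (\<alpha> i) \<otimes>\<^bsub>Q\<^esub> \<Xi>" for i
    by (simp add: W.letter_def \<Xi>)
  have word: "foldr (\<otimes>\<^bsub>Q\<^esub>) (map (\<lambda>i. \<phi> (\<alpha> i) \<otimes>\<^bsub>Q\<^esub> \<Xi>) w) \<one>\<^bsub>Q\<^esub> = W.word_eval w" for w
    by (simp add: W.word_eval_def letter[abs_def])
  have closed: "W.word_eval w \<in> carrier Q" if "w \<in> lists I" for w
    using that by (auto intro: W.word_eval_closed)
  \<comment> \<open>Padding with zero terms allows two elements of the free algebra to be evaluated
    over a common finite set of words.\<close>
  have eval: "free_eval K Q (scalar_embed D P \<iota>) (\<lambda>i. \<phi> (\<alpha> i) \<otimes>\<^bsub>Q\<^esub> \<Xi>) r =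
      (\<Oplus>\<^bsub>Q\<^esub>w\<in>V. \<phi> (scal (r w)) \<otimes>\<^bsub>Q\<^esub> W.word_eval w)"
    if "r \<in> free_algebra K I" "finite V" "V \<subseteq> lists I" "{w. r w \<noteq> \<zero>\<^bsub>K\<^esub>} \<subseteq> V" for r V
    unfolding free_eval_def word embed
  proof (rule Q.add.finprod_mono_neutral_cong_left[OF that(2,4)])
    have ev: "W.word_eval w \<in> carrier Q" if "w \<in> V" for w
      using that closed \<open>V \<subseteq> lists I\<close> by blast
    show "\<phi> (scal (r w)) \<otimes>\<^bsub>Q\<^esub> W.word_eval w = \<zero>\<^bsub>Q\<^esub>" if "w \<in> V - {w. r w \<noteq> \<zero>\<^bsub>K\<^esub>}" for w
      using that ev by (simp add: scal_def)
    show "(\<lambda>w. \<phi> (scal (r w)) \<otimes>\<^bsub>Q\<^esub> W.word_eval w) \<in> V \<rightarrow> carrier Q"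
      using \<open>r \<in> free_algebra K I\<close> ev by (simp add: free_algebra_def Pi_def)
  qed simp
  show ?thesis
    unfolding freely_generates_def
  proof (intro conjI inj_onI)
    show "(\<lambda>i. \<phi> (\<alpha> i) \<otimes>\<^bsub>Q\<^esub> \<Xi>) \<in> I \<rightarrow> carrier Q" using \<alpha> \<Xi>_closed by auto
    fix r s assume r: "r \<in> free_algebra K I" and s: "s \<in> free_algebra K I"
      and eq: "free_eval K Q (scalar_embed D P \<iota>) (\<lambda>i. \<phi> (\<alpha> i) \<otimes>\<^bsub>Q\<^esub> \<Xi>) r =
        free_eval K Q (scalar_embed D P \<iota>) (\<lambda>i. \<phi> (\<alpha> i) \<otimes>\<^bsub>Q\<^esub> \<Xi>) s"
    define V where "V = {w. r w \<noteq> \<zero>\<^bsub>K\<^esub>} \<union> {w. s w \<noteq> \<zero>\<^bsub>K\<^esub>}"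
    have V: "finite V" "V \<subseteq> lists I" using r s by (auto simp: V_def free_algebra_def)
    have rs: "r w \<in> carrier K" "s w \<in> carrier K" for w using r s by (auto simp: free_algebra_def)
    have ev: "W.word_eval w \<in> carrier Q" if "w \<in> V" for w using that V closed by blast
    \<comment> \<open>Two elements with equal values give a relation whose coefficients are the
      differences, again scalars and thus commuting with \<open>Y\<close>.\<close>
    define c where "c w = scal (r w \<ominus>\<^bsub>K\<^esub> s w)" for w
    have c: "c w \<in> carrier D" for w using rs by (simp add: c_def)
    let ?e = "\<lambda>t. \<Oplus>\<^bsub>Q\<^esub>w\<in>V. \<phi> (t w) \<otimes>\<^bsub>Q\<^esub> W.word_eval w"
    have "c w \<oplus> scal (s w) = scal (r w)" for w
      using rs by (simp add: c_def scal_minus a_minus_def[of D] M.a_assoc M.l_neg)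
    then have crs: "\<phi> (c w) \<oplus>\<^bsub>Q\<^esub> \<phi> (scal (s w)) = \<phi> (scal (r w))" for w
      using phi.hom_add[OF c scal_closed[OF rs(2)], of w w] by simp
    have "?e (\<lambda>w. scal (r w)) = (\<Oplus>\<^bsub>Q\<^esub>w\<in>V. \<phi> (c w) \<otimes>\<^bsub>Q\<^esub> W.word_eval w \<oplus>\<^bsub>Q\<^esub> \<phi> (scal (s w)) \<otimes>\<^bsub>Q\<^esub> W.word_eval w)"
    proof (rule Q.finsum_cong')
      show "(\<lambda>w. \<phi> (c w) \<otimes>\<^bsub>Q\<^esub> W.word_eval w \<oplus>\<^bsub>Q\<^esub> \<phi> (scal (s w)) \<otimes>\<^bsub>Q\<^esub> W.word_eval w) \<in> V \<rightarrow> carrier Q"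
        using c rs ev by simp
      show "\<phi> (scal (r w)) \<otimes>\<^bsub>Q\<^esub> W.word_eval w =
          \<phi> (c w) \<otimes>\<^bsub>Q\<^esub> W.word_eval w \<oplus>\<^bsub>Q\<^esub> \<phi> (scal (s w)) \<otimes>\<^bsub>Q\<^esub> W.word_eval w" if "w \<in> V" for w
        unfolding crs[symmetric] by (rule Q.l_distr) (use c rs ev that in simp_all)
    qed simp
    also have "\<dots> = ?e c \<oplus>\<^bsub>Q\<^esub> ?e (\<lambda>w. scal (s w))"
      by (rule Q.finsum_addf) (use c rs ev in auto)
    finally have "?e c \<oplus>\<^bsub>Q\<^esub> ?e (\<lambda>w. scal (s w)) = ?e (\<lambda>w. scal (s w))"
      using eq eval[OF r V] eval[OF s V] by (simp add: V_def)
    moreover have "?e c \<in> carrier Q" "?e (\<lambda>w. scal (s w)) \<in> carrier Q"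
      using c rs ev by (auto intro!: Q.finsum_closed)
    ultimately have sum: "?e c = \<zero>\<^bsub>Q\<^esub>" using Q.add.r_cancel_one by blast
    have c0: "c w = \<zero>" if "w \<in> V" for w
      by (rule W.words_independent[OF V _ _ sum that])
        (use rs in \<open>auto simp: c_def scal_Y_commute\<close>)
    show "r = s"
    proof
      fix w
      show "r w = s w"
      proof (cases "w \<in> V")
        case True
        then have "r w \<ominus>\<^bsub>K\<^esub> s w = \<zero>\<^bsub>K\<^esub>"
          by (intro scal_eq_zero K.minus_closed rs) (use c0[OF True] in \<open>simp add: c_def\<close>)
        then show ?thesis
          using K.minus_equality[of "r w" "\<ominus>\<^bsub>K\<^esub> s w"] rs by (simp add: a_minus_def[of K])
      qed (auto simp: V_def)
    qed
  qed
qed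

end

theorem theorem2p2:
  fixes K :: "('k, 'a) ring_scheme"
    and D :: "('k, 'd, 'm) module_scheme"
    and Q :: "('q, 'n) ring_scheme"
    and \<sigma> \<delta> \<psi> :: "'d \<Rightarrow> 'd"
    and \<iota> :: "(nat \<Rightarrow> 'd) \<Rightarrow> 'q"
    and a\<^sub>0 a\<^sub>1 b\<^sub>0 b\<^sub>1 :: 'k
    and \<alpha> :: "nat \<Rightarrow> 'd"
    and n :: nat
  defines "R \<equiv> skew_poly D \<sigma> \<delta>"
  defines "f \<equiv> linear_poly D R a\<^sub>0 a\<^sub>1"
    and "g \<equiv> linear_poly D R b\<^sub>0 b\<^sub>1"
  defines "\<Xi> \<equiv> \<iota> g \<otimes>\<^bsub>Q\<^esub> inv\<^bsub>Q\<^esub> (\<iota> f)"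
    and "\<psi> \<equiv> (\<lambda>x. a\<^sub>1 \<odot>\<^bsub>D\<^esub> \<delta> x \<oplus>\<^bsub>D\<^esub> a\<^sub>0 \<odot>\<^bsub>D\<^esub> (x \<ominus>\<^bsub>D\<^esub> \<sigma> x))"
  defines "E \<equiv> a_kernel D D \<psi>"
  assumes "division_algebra K D"
    and "k_automorphism K D \<sigma>"
    and "sigma_derivation K D \<sigma> \<delta>"
    and "division_ring_of_fractions R Q \<iota>"
    and "a\<^sub>0 \<in> carrier K" "a\<^sub>1 \<in> carrier K" "b\<^sub>0 \<in> carrier K" "b\<^sub>1 \<in> carrier K"
    and "a\<^sub>1 \<noteq> \<zero>\<^bsub>K\<^esub>"
    and "\<Xi> \<notin> scalar_embed D R \<iota> ` carrier K"
    and "n \<ge> 2"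
    and "\<alpha> \<in> {1..n} \<rightarrow> carrier D"
    and "left_lin_indep D (\<sigma> ` E) {1..n} \<alpha>"
    and "\<psi> ` carrier D \<inter> left_span D (\<sigma> ` E) {1..n} \<alpha> = {\<zero>\<^bsub>D\<^esub>}"
    and "b\<^sub>1 = \<zero>\<^bsub>K\<^esub> \<or> (b\<^sub>0 = \<zero>\<^bsub>K\<^esub> \<and> (\<forall>x \<in> carrier D. \<delta> x = \<zero>\<^bsub>D\<^esub>))"
  shows "freely_generates K Q (scalar_embed D R \<iota>) {1..n}
           (\<lambda>i. coeff_embed R \<iota> (\<alpha> i) \<otimes>\<^bsub>Q\<^esub> \<Xi>)"
proof -
  interpret L: linear_fraction K D \<sigma> \<delta> Q \<iota> a\<^sub>0 a\<^sub>1
    using assms by (auto simp: linear_fraction_def linear_fraction_axioms_def skew_fractions_def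
      skew_fractions_axioms_def skew_polynomials_def skew_polynomials_axioms_def)
  \<comment> \<open>What is left is to identify the objects of the statement with the constants of
    the locale.\<close>
  have R: "R = L.P" by (simp add: R_def L.P_def)
  have "f = L.lin a\<^sub>0 a\<^sub>1" "g = L.lin b\<^sub>0 b\<^sub>1"
    unfolding f_def g_def R
    by (intro L.linear_poly_eq \<open>a\<^sub>0 \<in> carrier K\<close> \<open>a\<^sub>1 \<in> carrier K\<close>
      \<open>b\<^sub>0 \<in> carrier K\<close> \<open>b\<^sub>1 \<in> carrier K\<close>)+
  then have \<Xi>: "\<Xi> = \<iota> (L.lin b\<^sub>0 b\<^sub>1) \<otimes>\<^bsub>Q\<^esub> L.Y"
    by (simp add: \<Xi>_def L.Y_def L.f_def)
  have \<psi>: "\<psi> = L.\<psi>"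
    by (simp add: \<psi>_def L.\<psi>_def fun_eq_iff)
  have indep: "left_lin_indep D (\<sigma> ` a_kernel D D L.\<psi>) {1..n} \<alpha>"
    and span: "L.\<psi> ` carrier D \<inter> left_span D (\<sigma> ` a_kernel D D L.\<psi>) {1..n} \<alpha> = {\<zero>\<^bsub>D\<^esub>}"
    using \<open>left_lin_indep D (\<sigma> ` E) {1..n} \<alpha>\<close>
      \<open>\<psi> ` carrier D \<inter> left_span D (\<sigma> ` E) {1..n} \<alpha> = {\<zero>\<^bsub>D\<^esub>}\<close>
    unfolding E_def \<psi> by simp_all
  show ?thesis
    using L.fraction_freely_generates[OF \<open>b\<^sub>0 \<in> carrier K\<close> \<open>b\<^sub>1 \<in> carrier K\<close> _ _
      \<open>\<alpha> \<in> {1..n} \<rightarrow> carrier D\<close> indep span] \<open>\<Xi> \<notin> scalar_embed D R \<iota> ` carrier K\<close>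
    unfolding R \<Xi> by simp
qed

end
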